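(* Consider estimating a unimodal and univariate symmetric Lebesgue density $q_Y(|y-\mu|^2)$, $y\in\mathbb{R}$, with $\mu\in(a,b)$ (respectively $\mu\in(a,\infty)$), under integrated $L_1$ loss and based on $X\sim p_X(|x-\mu|^2)$ with $p_X(t^2)$ logconcave in $t$. The plug-in density estimator $q_Y(|y-\hat\mu_U(X)|^2)$, with $\hat\mu_U(X)$ the Bayes estimator of $\mu$ with respect to the uniform prior on $(a,b)$ (respectively on $(a,\infty)$) and the loss $2F\left(\frac{|\hat\mu-\mu|}{2}\right)-1$, dominates the plug-in density estimator $q_Y(|y-X|^2)$.
   Context: $F$ is the cdf of a random variable with density $q_Y(y^2)$, $y\in\mathbb{R}$; $-\infty<a<b<\infty$. The integrated $L_1$ loss of an estimate $\hat q(\cdot;x)$ is $\int_{\mathbb{R}}|q_Y(|y-\mu|^2)-\hat q(y;x)|\,dy$; risk is the expectation over $X$. One estimator dominates another if its risk is $\le$ for all $\mu$ in the restricted parameter space with strict inequality for some such $\mu$. The Bayes estimator minimizes the posterior expected loss. Unimodal means $q_Y(y^2)$ is non-increasing in $|y|$.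
   Formalization: The Bayes estimator need not be unique (e.g. uniform densities), and then not every choice dominates; proved here: some Bayes estimator always dominates q_Y(|y-X|^2), and the Bayes estimator does whenever it is unique up to null sets. *)

theory Defs
  imports "HOL-Probability.Probability"
begin

section \<open>Symmetric location densities on the line\<close>

text \<open>Densities are given in the form \<open>f (\<bar>t - \<mu>\<bar>\<^sup>2)\<close>, so only the values of \<open>f\<close> on the
  nonnegative half-line are ever used.\<close>

definition symmetric_density :: "(real \<Rightarrow> real) \<Rightarrow> bool" where
  "symmetric_density f \<longleftrightarrow>
     (\<lambda>t. f (t\<^sup>2)) \<in> borel_measurable lborel \<and> (\<forall>t. 0 \<le> f (t\<^sup>2)) \<and>
     (\<integral>\<^sup>+ t. ennreal (f (t\<^sup>2)) \<partial>lborel) = 1"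

definition unimodal_symmetric :: "(real \<Rightarrow> real) \<Rightarrow> bool" where
  "unimodal_symmetric f \<longleftrightarrow> (\<forall>y z. \<bar>y\<bar> \<le> \<bar>z\<bar> \<longrightarrow> f (z\<^sup>2) \<le> f (y\<^sup>2))"

text \<open>For nonnegative \<open>g\<close>, with the convention \<open>ln 0 = -\<infinity>\<close>. Note that \<open>concave_on\<close> includes
  convexity of the set, here \<open>{t. 0 < g t}\<close>; zeros of \<open>g\<close> are allowed.\<close>

definition logconcave :: "(real \<Rightarrow> real) \<Rightarrow> bool" where
  "logconcave g \<longleftrightarrow> concave_on {t. 0 < g t} (\<lambda>t. ln (g t))"

definition location_measure :: "(real \<Rightarrow> real) \<Rightarrow> real \<Rightarrow> real measure" where
  "location_measure f \<mu> = density lborel (\<lambda>t. ennreal (f (\<bar>t - \<mu>\<bar>\<^sup>2)))"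


section \<open>Density estimation under integrated L1 loss\<close>

text \<open>A density estimator \<open>qhat\<close> takes the observation \<open>x\<close> first and then the point \<open>y\<close>.
  Loss and risk are extended nonnegative Lebesgue integrals, so that no integrability side
  conditions are hidden.\<close>

definition L1_loss :: "(real \<Rightarrow> real) \<Rightarrow> real \<Rightarrow> (real \<Rightarrow> real) \<Rightarrow> ennreal" where
  "L1_loss q \<mu> g = (\<integral>\<^sup>+ y. ennreal \<bar>q (\<bar>y - \<mu>\<bar>\<^sup>2) - g y\<bar> \<partial>lborel)"

definition L1_risk :: "(real \<Rightarrow> real) \<Rightarrow> (real \<Rightarrow> real) \<Rightarrow> (real \<Rightarrow> real \<Rightarrow> real) \<Rightarrow> real \<Rightarrow> ennreal" where
  "L1_risk q p qhat \<mu> = (\<integral>\<^sup>+ x. L1_loss q \<mu> (qhat x) \<partial>location_measure p \<mu>)"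

definition dominates ::
    "(real \<Rightarrow> real) \<Rightarrow> (real \<Rightarrow> real) \<Rightarrow> real set \<Rightarrow>
     (real \<Rightarrow> real \<Rightarrow> real) \<Rightarrow> (real \<Rightarrow> real \<Rightarrow> real) \<Rightarrow> bool" where
  "dominates q p S qhat1 qhat2 \<longleftrightarrow>
     (\<forall>\<mu>\<in>S. L1_risk q p qhat1 \<mu> \<le> L1_risk q p qhat2 \<mu>) \<and>
     (\<exists>\<mu>\<in>S. L1_risk q p qhat1 \<mu> < L1_risk q p qhat2 \<mu>)"

definition plug_in :: "(real \<Rightarrow> real) \<Rightarrow> (real \<Rightarrow> real) \<Rightarrow> real \<Rightarrow> real \<Rightarrow> real" where
  "plug_in q \<delta> x y = q (\<bar>y - \<delta> x\<bar>\<^sup>2)"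


section \<open>Bayes point estimation for the uniform prior on a parameter set\<close>

definition dual_loss :: "(real \<Rightarrow> real) \<Rightarrow> real \<Rightarrow> real \<Rightarrow> real" where
  "dual_loss q d \<mu> = 2 * cdf (location_measure q 0) (\<bar>d - \<mu>\<bar> / 2) - 1"

text \<open>The prior density is \<open>1\<close> on \<open>S\<close>. The prior may be improper; for bounded \<open>S\<close>, normalising it
  leaves the posterior unchanged.\<close>

definition marginal :: "(real \<Rightarrow> real) \<Rightarrow> real set \<Rightarrow> real \<Rightarrow> real" where
  "marginal p S x = (LINT \<mu>:S|lborel. p (\<bar>x - \<mu>\<bar>\<^sup>2))"

definition posterior :: "(real \<Rightarrow> real) \<Rightarrow> real set \<Rightarrow> real \<Rightarrow> real measure" where
  "posterior p S x =
     density lborel (\<lambda>\<mu>. ennreal (indicator S \<mu> * p (\<bar>x - \<mu>\<bar>\<^sup>2) / marginal p S x))"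

definition posterior_loss :: "(real \<Rightarrow> real) \<Rightarrow> (real \<Rightarrow> real) \<Rightarrow> real set \<Rightarrow> real \<Rightarrow> real \<Rightarrow> real" where
  "posterior_loss q p S x d = (LINT \<mu>|posterior p S x. dual_loss q d \<mu>)"

text \<open>The posterior exists only where the marginal is positive; the remaining \<open>x\<close> have probability
  zero under every \<open>\<mu> \<in> S\<close>, and the value of an estimator there is unconstrained.\<close>

definition bayes_estimator ::
    "(real \<Rightarrow> real) \<Rightarrow> (real \<Rightarrow> real) \<Rightarrow> real set \<Rightarrow> (real \<Rightarrow> real) \<Rightarrow> bool" where
  "bayes_estimator q p S \<delta> \<longleftrightarrow> \<delta> \<in> borel_measurable borel \<and>
     (\<forall>x. 0 < marginal p S x \<longrightarrow>
        (\<forall>d. posterior_loss q p S x (\<delta> x) \<le> posterior_loss q p S x d))"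

text \<open>Posterior loss minimisers can be non-unique when \<open>q\<close> vanishes far out. The next predicate
  says that \<open>\<delta>\<close> is the only Bayes estimator, up to a null set of observations.\<close>

definition essentially_unique_bayes_estimator ::
    "(real \<Rightarrow> real) \<Rightarrow> (real \<Rightarrow> real) \<Rightarrow> real set \<Rightarrow> (real \<Rightarrow> real) \<Rightarrow> bool" where
  "essentially_unique_bayes_estimator q p S \<delta> \<longleftrightarrow> bayes_estimator q p S \<delta> \<and>
     (\<forall>\<delta>'. bayes_estimator q p S \<delta>' \<longrightarrow>
        (AE x in lborel. 0 < marginal p S x \<longrightarrow> \<delta>' x = \<delta> x))"

end

theory Submission
  imports Defs
begin

text \<open>
  Write \<open>f t = p (t\<^sup>2)\<close> and \<open>k t = q ((t / 2)\<^sup>2)\<close>. By unimodality, \<open>y \<mapsto> q (\<bar>y - \<mu>\<bar>\<^sup>2) - q (\<bar>y - d\<bar>\<^sup>2)\<close>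
  changes sign only at the midpoint of \<open>\<mu>\<close> and \<open>d\<close>, so the \<open>L\<^sub>1\<close> loss of a plug-in density is exactly
  twice the dual loss of its plugged-in point (\<open>L1_loss_location\<close>). It remains to compare the point
  estimators \<open>X\<close> and \<open>\<delta> X\<close> under the loss \<open>\<rho> (d - \<mu>)\<close>, where \<open>\<rho>\<close> has derivative
  \<open>\<kappa> t = sgn t * k t\<close>. This loss is bowl-shaped, but concave on each side of its minimum.

  The derivative in \<open>d\<close> of the unnormalised posterior loss at the observation \<open>x\<close> is
  \<open>score d x = \<integral>\<^bsub>S\<^esub> \<kappa> (d - m) f (x - m) dm\<close>. Two monotonicity properties carry everything.
  First, if \<open>d - x\<close> is kept fixed, the score is non-decreasing in \<open>x\<close> while \<open>d\<close> stays in
  the closure of \<open>S\<close>, because the integrand in the variable \<open>u = x - m\<close> is a fixed function with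
  one sign change and only the window of admissible \<open>u\<close> moves (\<open>score_shift_mono\<close>). Secondly, for fixed \<open>x\<close> the score has a single sign change in \<open>d\<close>; this is
  where logconcavity enters, as monotone likelihood ratio of the shifts of \<open>f\<close>
  (\<open>score_single_crossing\<close>). Hence the point \<open>\<delta> x\<close> of sign change minimises the posterior loss, and
  the shift \<open>\<delta> x - x\<close> is non-increasing in \<open>x\<close> (\<open>\<delta>_maximises_tail\<close>, \<open>\<delta>_shift_antimono\<close>).

  The risk difference is then treated in the spirit of Kubokawa's integral expression. The loss
  difference \<open>\<rho> (x - \<mu>) - \<rho> (\<delta> x - \<mu>)\<close> is an integral of \<open>\<kappa> (x - \<mu> + s)\<close> over the shifts \<open>s\<close> between
  \<open>0\<close> and \<open>\<delta> x - x\<close>. After exchanging the integrals, each \<open>s\<close> contributes an integral of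
  \<open>\<psi> s u = \<kappa> (u + s) * f u\<close> over those \<open>x = u + \<mu>\<close> with \<open>\<delta> x - x < s\<close> (for \<open>s \<le> 0\<close>) or
  \<open>\<delta> x - x > s\<close> (for \<open>s > 0\<close>) (\<open>integral_gain\<close>). By monotonicity these sets are rays. For an
  observation \<open>x\<close> inside the ray and close to its end point, the integral over the ray compares
  pointwise with \<open>score (x + s) x\<close>, whose sign is known (\<open>upper_ray_integral_nonneg\<close>,
  \<open>lower_ray_integral_nonpos\<close>). Organising the exchange by \<open>s\<close> instead of \<open>x\<close> means that
  \<open>x \<mapsto> \<delta> x - x\<close> need not be continuous, let alone differentiable.

  For strictness, \<open>\<mu>\<close> is taken close to the end point \<open>a\<close> and \<open>s\<close> slightly larger than \<open>\<delta> a - a\<close>, so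
  that only observations \<open>x \<le> a\<close> are involved. For these the posterior density is non-increasing on \<open>S\<close>, and a
  reflection argument bounds \<open>\<delta> x\<close> well enough to make the comparison strict
  (\<open>score_nonneg_reflection\<close>, \<open>gain_pos\<close>).

  Finally, an essentially unique Bayes estimator agrees with \<open>\<delta>\<close> almost everywhere on the event of
  positive marginal density, which has probability one under every \<open>\<mu> \<in> S\<close>, so it has the same risk.
\<close>

section \<open>Integrals on the line\<close>

text \<open>The integrability needed for the two exchanges of integrals below: translating \<open>g\<close> by an amount
  depending on \<open>x\<close> does not change its norm.\<close>

lemma integrable_shear:
  fixes f g h :: "real \<Rightarrow> real"
  assumes f: "integrable lborel f" and g: "integrable lborel g" and [measurable]: "h \<in> borel_measurable borel"
  shows "integrable (lborel \<Otimes>\<^sub>M lborel) (\<lambda>(x, t). f x * g (t + h x))"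
proof (rule lborel_pair.Fubini_integrable)
  have [measurable]: "f \<in> borel_measurable borel" "g \<in> borel_measurable borel"
    using f g by (auto dest: borel_measurable_integrable)
  show "(\<lambda>(x, t). f x * g (t + h x)) \<in> borel_measurable (lborel \<Otimes>\<^sub>M lborel)"
    by measurable
  have shift: "integrable lborel (\<lambda>t. g (t + c))" for c
    using lborel_integrable_real_affine[OF g, of 1 c] by (simp add: add.commute)
  have "(\<integral>t. norm (f x * g (t + h x)) \<partial>lborel) = \<bar>f x\<bar> * (\<integral>t. \<bar>g t\<bar> \<partial>lborel)" for x
    using lborel_integral_real_affine[of 1 "\<lambda>t. \<bar>g t\<bar>" "h x"] by (simp add: abs_mult add.commute)
  then show "integrable lborel (\<lambda>x. \<integral>t. norm (case (x, t) of (x, t) \<Rightarrow> f x * g (t + h x)) \<partial>lborel)"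
    using f by simp
  show "AE x in lborel. integrable lborel (\<lambda>t. case (x, t) of (x, t) \<Rightarrow> f x * g (t + h x))"
    using shift by simp
qed

lemma integral_less_on_interval:
  fixes F G :: "real \<Rightarrow> real"
  assumes "integrable lborel F" "integrable lborel G"
    and le: "\<And>u. F u \<le> G u" and "l < r" and less: "\<And>u. l < u \<Longrightarrow> u < r \<Longrightarrow> F u < G u"
  shows "(\<integral>u. F u \<partial>lborel) < (\<integral>u. G u \<partial>lborel)"
proof -
  have int: "integrable lborel (\<lambda>u. G u - F u)" using assms by simp
  have "(\<integral>u. G u - F u \<partial>lborel) \<noteq> 0"
  proof
    assume "(\<integral>u. G u - F u \<partial>lborel) = 0"
    then have "AE u in lborel. G u - F u = 0"
      using integral_nonneg_eq_0_iff_AE[OF int] le by simp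
    then have "AE u in lborel. u \<notin> {l<..<r}"
      by (rule eventually_mono) (use less in force)
    then have "{l<..<r} \<in> null_sets lborel"
      by (subst (asm) AE_iff_null_sets[symmetric]) auto
    then show False using \<open>l < r\<close> by (simp add: null_sets_def)
  qed
  moreover have "0 \<le> (\<integral>u. G u - F u \<partial>lborel)"
    using le by (intro integral_nonneg_AE) simp
  ultimately show ?thesis using assms by simp
qed

lemma even_unimodal_pos_near_0:
  fixes k :: "real \<Rightarrow> real"
  assumes nonneg: "\<And>t. 0 \<le> k t" and mono: "\<And>y z. \<bar>y\<bar> \<le> \<bar>z\<bar> \<Longrightarrow> k z \<le> k y"
    and pos: "(\<integral>t. k t \<partial>lborel) > 0"
  obtains e where "0 < e" and "\<And>t. \<bar>t\<bar> < e \<Longrightarrow> 0 < k t"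
proof -
  have "\<exists>t. t \<noteq> 0 \<and> k t \<noteq> 0"
  proof (rule ccontr)
    assume "\<not> ?thesis"
    then have "AE t in lborel. k t = 0" using AE_lborel_singleton[of 0] by (auto elim: eventually_mono)
    then have "(\<integral>t. k t \<partial>lborel) = 0" by (rule integral_eq_zero_AE)
    with pos show False by simp
  qed
  then obtain t where t: "t \<noteq> 0" "0 < k t" using nonneg by (metis less_eq_real_def)
  show ?thesis by (rule that[of "\<bar>t\<bar>"]) (use t mono in \<open>auto intro: less_le_trans\<close>)
qed

section \<open>Posterior score of a bowl-shaped loss\<close>

text \<open>Here \<open>k\<close> is the modulus of the derivative of the loss and \<open>f\<close> the density of the noise. The
  inequality for \<open>f\<close> is logconcavity without division or logarithms, so that zeros of \<open>f\<close> are
  covered. The conditions on \<open>S\<close> describe an open interval with left end point \<open>a\<close>, bounded or not,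
  and allow both parameter spaces to be treated at once.\<close>

locale restricted_location =
  fixes k f :: "real \<Rightarrow> real" and S :: "real set" and a :: real
  assumes k_int: "integrable lborel k" and k_nonneg: "\<And>t. 0 \<le> k t"
    and k_mono: "\<And>y z. \<bar>y\<bar> \<le> \<bar>z\<bar> \<Longrightarrow> k z \<le> k y" and k_pos: "(\<integral>t. k t \<partial>lborel) > 0"
    and f_int: "integrable lborel f" and f_nonneg: "\<And>t. 0 \<le> f t"
    and f_mono: "\<And>y z. \<bar>y\<bar> \<le> \<bar>z\<bar> \<Longrightarrow> f z \<le> f y" and f_pos: "(\<integral>t. f t \<partial>lborel) > 0"
    and f_logconcave: "\<And>x y w. x \<le> y \<Longrightarrow> y \<le> w \<Longrightarrow> f x * f w \<le> f y * f (x + w - y)"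
    and S_meas [measurable]: "S \<in> sets borel" and S_nonempty: "S \<noteq> {}"
    and S_lower: "\<And>m. m \<in> S \<Longrightarrow> a < m"
    and S_down: "\<And>m n. m \<in> S \<Longrightarrow> a < n \<Longrightarrow> n \<le> m \<Longrightarrow> n \<in> S"
    and S_up: "\<And>m. m \<in> S \<Longrightarrow> \<exists>n\<in>S. m < n"
begin

lemma k_meas [measurable]: "k \<in> borel_measurable borel"
  using k_int by (auto dest: borel_measurable_integrable)

lemma f_meas [measurable]: "f \<in> borel_measurable borel"
  using f_int by (auto dest: borel_measurable_integrable)

text \<open>The derivative of the loss.\<close>

definition \<kappa> :: "real \<Rightarrow> real" where "\<kappa> t = sgn t * k t"

lemma \<kappa>_meas [measurable]: "\<kappa> \<in> borel_measurable borel"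
  unfolding \<kappa>_def by measurable

lemma abs_\<kappa>: "\<bar>\<kappa> t\<bar> \<le> k t"
  using k_nonneg[of t] k_nonneg[of 0] by (simp add: \<kappa>_def abs_mult abs_sgn_eq)

lemma \<kappa>_int: "integrable lborel \<kappa>"
  by (rule Bochner_Integration.integrable_bound[OF k_int]) (use abs_\<kappa> k_nonneg in auto)

lemma k_even: "k (- t) = k t"
  by (intro antisym k_mono) auto

lemma f_even: "f (- t) = f t"
  by (intro antisym f_mono) auto

lemma \<kappa>_nonneg: "0 \<le> t \<Longrightarrow> 0 \<le> \<kappa> t" and \<kappa>_nonpos: "t \<le> 0 \<Longrightarrow> \<kappa> t \<le> 0"
  using k_nonneg[of t] by (auto simp: \<kappa>_def sgn_if)

lemma \<kappa>_odd: "\<kappa> (- t) = - \<kappa> t"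
  by (simp add: \<kappa>_def k_even sgn_minus)

text \<open>The integrand of the score and of the gain, in the noise variable \<open>u\<close> and at a fixed shift \<open>s\<close>.
  Its only sign change is at \<open>- s\<close>.\<close>

definition \<psi> :: "real \<Rightarrow> real \<Rightarrow> real" where "\<psi> s u = \<kappa> (u + s) * f u"

lemma \<psi>_nonneg: "- s \<le> u \<Longrightarrow> 0 \<le> \<psi> s u" and \<psi>_nonpos: "u \<le> - s \<Longrightarrow> \<psi> s u \<le> 0"
  unfolding \<psi>_def using f_nonneg[of u] \<kappa>_nonneg[of "u + s"] \<kappa>_nonpos[of "u + s"]
  by (auto simp: mult_nonpos_nonneg)

lemma \<psi>_meas [measurable]: "(\<lambda>u. \<psi> s u) \<in> borel_measurable borel"
  unfolding \<psi>_def by measurable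

lemma \<psi>_int: "integrable lborel (\<psi> s)"
proof (rule Bochner_Integration.integrable_bound)
  show "integrable lborel (\<lambda>u. k 0 * f u)" using f_int by simp
  have "\<bar>\<psi> s u\<bar> \<le> k 0 * f u" for u
  proof -
    have "\<bar>\<kappa> (u + s)\<bar> \<le> k 0" using abs_\<kappa>[of "u + s"] k_mono[of 0 "u + s"] by simp
    then show ?thesis using f_nonneg[of u] by (simp add: \<psi>_def abs_mult mult_right_mono)
  qed
  then show "AE u in lborel. norm (\<psi> s u) \<le> norm (k 0 * f u)"
    using f_nonneg k_nonneg by (simp add: abs_mult)
qed measurable

lemma \<psi>_indicator_int: "A \<in> sets borel \<Longrightarrow> integrable lborel (\<lambda>u. indicator A u * \<psi> s u)"
  using integrable_mult_indicator[OF _ \<psi>_int, of A s] by simp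

lemma \<psi>_S_int: "integrable lborel (\<lambda>u. indicator S (x - u) * \<psi> s u)"
proof -
  have "(\<lambda>u. x - u) -` S \<in> sets borel" using measurable_sets[of "\<lambda>u. x - u" borel borel S] by simp
  from \<psi>_indicator_int[OF this] show ?thesis by (simp add: indicator_def)
qed

text \<open>The derivative in \<open>d\<close> of the unnormalised posterior loss at the observation \<open>x\<close>.\<close>

definition score :: "real \<Rightarrow> real \<Rightarrow> real" where
  "score d x = (\<integral>m. indicator S m * (\<kappa> (d - m) * f (x - m)) \<partial>lborel)"

lemma score_eq: "score (x + s) x = (\<integral>u. indicator S (x - u) * \<psi> s u \<partial>lborel)"
  unfolding score_def \<psi>_def
  by (subst lborel_integral_real_affine[where c = "-1" and t = x]) (simp_all add: algebra_simps)

lemma score_eq': "score d (d - s) = (\<integral>v. indicator S (d - v) * (\<kappa> v * f (v - s)) \<partial>lborel)"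
  unfolding score_def
  by (subst lborel_integral_real_affine[where c = "-1" and t = d]) (simp_all add: algebra_simps)

lemma score_nonpos: "d \<le> a \<Longrightarrow> score d x \<le> 0"
proof -
  assume "d \<le> a"
  then have "0 \<le> (\<integral>m. - (indicator S m * (\<kappa> (d - m) * f (x - m))) \<partial>lborel)"
    by (intro integral_nonneg_AE AE_I2)
       (use S_lower \<kappa>_nonpos f_nonneg in \<open>force simp: indicator_def mult_nonpos_nonneg\<close>)
  then show ?thesis by (simp add: score_def)
qed

lemma score_nonneg: "(\<And>m. m \<in> S \<Longrightarrow> m \<le> d) \<Longrightarrow> 0 \<le> score d x"
  unfolding score_def
  by (intro integral_nonneg_AE AE_I2) (use \<kappa>_nonneg f_nonneg in \<open>auto simp: indicator_def\<close>)

text \<open>In the variable \<open>u = x - m\<close> only the window \<open>{u. x - u \<in> S}\<close> depends on \<open>x\<close>. As long as the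
  estimate \<open>x + s\<close> stays in the closure of \<open>S\<close>, the window contains the sign change \<open>- s\<close> of \<open>\<psi> s\<close> or has it on its
  boundary; moving it to the right adds nonnegative and removes nonpositive values.\<close>

lemma score_shift_mono:
  assumes "x \<le> x'" "a \<le> x + s" "m \<in> S" "x' + s \<le> m"
  shows "score (x + s) x \<le> score (x' + s) x'"
  unfolding score_eq
proof (rule integral_mono[OF \<psi>_S_int \<psi>_S_int])
  fix u
  show "indicator S (x - u) * \<psi> s u \<le> indicator S (x' - u) * \<psi> s u"
  proof (cases "- s \<le> u")
    case True
    have "x' - u \<in> S" if "x - u \<in> S"
      by (rule S_down[OF assms(3)]) (use S_lower[OF that] assms True in auto)
    then show ?thesis using \<psi>_nonneg[OF True] by (auto simp: indicator_def)
  next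
    case False
    have "x - u \<in> S" if "x' - u \<in> S"
      by (rule S_down[OF that]) (use assms False in auto)
    then show ?thesis using \<psi>_nonpos[of u s] False by (auto simp: indicator_def)
  qed
qed

text \<open>For fixed \<open>d\<close>, increasing the shift multiplies the weight \<open>f (v - s)\<close> by the likelihood ratio
  \<open>f (v - s') / f (v - s)\<close>, which is increasing in \<open>v\<close>. Its value \<open>c\<close> at \<open>v = 0\<close>, where \<open>\<kappa>\<close> changes sign,
  separates the two sides: the new integrand dominates \<open>c\<close> times the old one.\<close>

lemma score_sign_tp2:
  assumes "s \<le> s'" and pos: "0 < score d (d - s)"
  shows "0 \<le> score d (d - s')"
proof (cases "f (- s) = 0")
  \<comment> \<open>The ratio at \<open>0\<close> is undefined; unimodality of \<open>f\<close> then kills one side of the integral.\<close>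
  case True
  show ?thesis
  proof (cases "0 \<le> s")
    case s: True
    have "f (v - s') = 0" if "v < 0" for v
      using f_mono[of "- s" "v - s'"] f_nonneg[of "v - s'"] True s that assms(1) by simp
    then have "0 \<le> \<kappa> v * f (v - s')" for v
      using \<kappa>_nonneg[of v] f_nonneg[of "v - s'"] by (cases "0 \<le> v") auto
    then show ?thesis unfolding score_eq' by (intro integral_nonneg_AE AE_I2) auto
  next
    case s: False
    have "f (v - s) = 0" if "0 < v" for v
      using f_mono[of "- s" "v - s"] f_nonneg[of "v - s"] True s that by simp
    then have "\<kappa> v * f (v - s) \<le> 0" for v
      using \<kappa>_nonpos[of v] f_nonneg[of "v - s"] by (cases "0 < v") (auto simp: mult_nonpos_nonneg)
    then have "0 \<le> (\<integral>v. - (indicator S (d - v) * (\<kappa> v * f (v - s))) \<partial>lborel)"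
      by (intro integral_nonneg_AE AE_I2) (auto simp: indicator_def)
    with pos show ?thesis by (simp add: score_eq')
  qed
next
  case False
  then have fs: "0 < f (- s)" using f_nonneg[of "- s"] by simp
  define c where "c = f (- s') / f (- s)"
  have int: "integrable lborel (\<lambda>v. indicator S (d - v) * (\<kappa> v * f (v - r)))" for r
  proof -
    have "integrable lborel (\<lambda>v. indicator S ((d - r) - (- r + 1 * v)) * \<psi> r (- r + 1 * v))"
      by (rule lborel_integrable_real_affine[OF \<psi>_S_int]) simp
    then show ?thesis by (simp add: \<psi>_def algebra_simps)
  qed
  have "c * (\<kappa> v * f (v - s)) \<le> \<kappa> v * f (v - s')" for v
  proof (cases "0 \<le> v")
    case True
    have "f (- s') * f (v - s) \<le> f (- s) * f (v - s')"
      using f_logconcave[of "- s'" "- s" "v - s"] True assms(1) by (simp add: algebra_simps)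
    then have "c * f (v - s) \<le> f (v - s')" using fs by (simp add: c_def field_simps)
    from mult_left_mono[OF this \<kappa>_nonneg[OF True]] show ?thesis by (simp add: algebra_simps)
  next
    case False
    have "f (v - s') * f (- s) \<le> f (- s') * f (v - s)"
      using f_logconcave[of "v - s'" "- s'" "- s"] False assms(1) by (simp add: algebra_simps)
    then have "f (v - s') \<le> c * f (v - s)" using fs by (simp add: c_def field_simps)
    from mult_left_mono_neg[OF this \<kappa>_nonpos[of v]] False show ?thesis by (simp add: algebra_simps)
  qed
  then have "c * (indicator S (d - v) * (\<kappa> v * f (v - s))) \<le> indicator S (d - v) * (\<kappa> v * f (v - s'))" for v
    by (auto simp: indicator_def)
  then have "(\<integral>v. c * (indicator S (d - v) * (\<kappa> v * f (v - s))) \<partial>lborel) \<le> score d (d - s')"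
    unfolding score_eq' by (intro integral_mono int integrable_mult_right) auto
  then have "c * score d (d - s) \<le> score d (d - s')" by (simp add: score_eq')
  moreover have "0 \<le> c" using fs f_nonneg[of "- s'"] by (simp add: c_def)
  ultimately show ?thesis using pos by (meson mult_nonneg_nonneg less_imp_le order_trans)
qed

text \<open>Passing from \<open>d\<close> to \<open>d'\<close> at fixed \<open>x\<close> is split into a move with \<open>d - x\<close> fixed, where the score
  increases, followed by a change of the shift at fixed \<open>d'\<close>, which preserves positivity up to zero.\<close>

lemma score_single_crossing:
  assumes "0 < score d x" "d \<le> d'"
  shows "0 \<le> score d' x"
proof (cases "\<exists>m\<in>S. d' \<le> m")
  case True
  then obtain m where m: "m \<in> S" "d' \<le> m" by auto
  have "a < d" using assms(1) score_nonpos[of d x] by (meson not_le)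
  then have "score d x \<le> score d' (d' - (d - x))"
    using score_shift_mono[of x "d' - (d - x)" "d - x" m] m assms by simp
  then have "0 \<le> score d' (d' - (d' - x))"
    using assms by (intro score_sign_tp2[of "d - x"]) auto
  then show ?thesis by simp
next
  case False
  then show ?thesis by (intro score_nonneg) (meson linear)
qed

text \<open>The supremum of the loss minus its value at the error \<open>w\<close>; this is one minus the loss if \<open>k\<close> has
  integral \<open>2\<close>. The representation without case distinction on the sign of
  \<open>w\<close> is possible because \<open>\<kappa>\<close> is odd; it makes loss differences integrals of \<open>\<kappa>\<close> over an interval.\<close>

definition tail :: "real \<Rightarrow> real" where
  "tail w = (\<integral>t. indicator {w<..} t * \<kappa> t \<partial>lborel)"

lemma \<kappa>_indicator_int: "A \<in> sets borel \<Longrightarrow> integrable lborel (\<lambda>t. indicator A t * \<kappa> t)"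
  using integrable_mult_indicator[OF _ \<kappa>_int, of A] by simp

lemma tail_meas [measurable]: "tail \<in> borel_measurable borel"
  unfolding tail_def indicator_def greaterThan_iff by measurable

lemma tail_even: "tail (- w) = tail w"
proof -
  have "(\<integral>t. \<kappa> t \<partial>lborel) = - (\<integral>t. \<kappa> t \<partial>lborel)"
    by (subst lborel_integral_real_affine[where c = "-1" and t = 0]) (simp_all add: \<kappa>_odd)
  then have 0: "(\<integral>t. \<kappa> t \<partial>lborel) = 0" by simp
  have "tail (- w) = (\<integral>t. indicator {- w<..} (- t) * \<kappa> (- t) \<partial>lborel)"
    unfolding tail_def by (subst lborel_integral_real_affine[where c = "-1" and t = 0]) simp_all
  also have "\<dots> = (\<integral>t. indicator {w<..} t * \<kappa> t - \<kappa> t \<partial>lborel)"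
    by (rule integral_cong_AE) (use AE_lborel_singleton[of w] in \<open>auto simp: indicator_def \<kappa>_odd elim!: eventually_mono\<close>)
  also have "\<dots> = tail w"
    using 0 \<kappa>_int \<kappa>_indicator_int[of "{w<..}"] by (simp add: tail_def)
  finally show ?thesis .
qed

lemma tail_abs: "tail \<bar>w\<bar> = tail w"
  using tail_even by (simp add: abs_if)

lemma tail_nonneg: "0 \<le> tail w"
proof -
  have "0 \<le> tail \<bar>w\<bar>" unfolding tail_def
    by (intro integral_nonneg_AE AE_I2) (use \<kappa>_nonneg in \<open>auto simp: indicator_def\<close>)
  then show ?thesis by (simp add: tail_abs)
qed

lemma tail_pos:
  assumes "\<And>t. \<bar>t\<bar> < e \<Longrightarrow> 0 < k t" and "\<bar>w\<bar> < e"
  shows "0 < tail w"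
proof -
  have "(\<integral>t. 0 \<partial>(lborel :: real measure)) < tail \<bar>w\<bar>" unfolding tail_def
    by (rule integral_less_on_interval[of _ _ "\<bar>w\<bar>" e])
       (use assms k_nonneg \<kappa>_indicator_int[of "{\<bar>w\<bar><..}"] in \<open>auto simp: indicator_def \<kappa>_def sgn_if\<close>)
  then show ?thesis by (simp add: tail_abs)
qed

lemma tail_shift_eq: "tail (e - m) = (\<integral>t. indicator {e<..} t * \<kappa> (t - m) \<partial>lborel)"
  unfolding tail_def
  by (subst lborel_integral_real_affine[where c = 1 and t = "- m"]) (simp_all add: indicator_def algebra_simps)

lemma tail_diff_shift:
  "tail (w - m) - tail (v - m) = (\<integral>t. (indicator {w<..} t - indicator {v<..} t) * \<kappa> (t - m) \<partial>lborel)"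
proof -
  have i: "integrable lborel (\<lambda>t. indicator {w<..} t * \<kappa> (t - m))" for w
    using lborel_integrable_real_affine[OF \<kappa>_indicator_int[of "{w - m<..}"], of 1 "- m"]
    by (simp add: indicator_def algebra_simps)
  show ?thesis unfolding tail_shift_eq
    by (subst Bochner_Integration.integral_diff[symmetric, OF i i]) (simp add: algebra_simps)
qed


section \<open>The Bayes estimator\<close>

definition descent :: "real \<Rightarrow> real set" where
  "descent x = insert a {d. a < d \<and> score d x < 0}"

text \<open>The smallest minimiser of the posterior loss in the half-line from \<open>a\<close> on. When minimisers are
  not unique, choosing the smallest keeps \<open>\<delta> x\<close> close to \<open>a\<close> for \<open>x \<le> a\<close>, as the strict
  inequality between the risks requires.\<close>

definition \<delta> :: "real \<Rightarrow> real" where "\<delta> x = Sup (descent x)"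

text \<open>Integrating the score in \<open>d\<close> recovers posterior losses: \<open>c\<close> will be an indicator of a half-line,
  or a difference of two.\<close>

lemma integral_score:
  assumes [measurable]: "c \<in> borel_measurable borel" and c: "\<And>t. \<bar>c t\<bar> \<le> (1::real)"
  shows "integrable lborel (\<lambda>t. c t * score t x)"
    and "(\<integral>m. indicator S m * f (x - m) * (\<integral>t. c t * \<kappa> (t - m) \<partial>lborel) \<partial>lborel)
          = (\<integral>t. c t * score t x \<partial>lborel)"
    and "integrable lborel (\<lambda>m. indicator S m * f (x - m) * (\<integral>t. c t * \<kappa> (t - m) \<partial>lborel))"
proof -
  have "integrable lborel (\<lambda>m. indicator S m * f (x - m))"
    using integrable_mult_indicator[of S lborel "\<lambda>m. f (x - m)"]
      lborel_integrable_real_affine[OF f_int, of "-1" x] by simp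
  from integrable_shear[OF this \<kappa>_int, of uminus]
  have i0: "integrable (lborel \<Otimes>\<^sub>M lborel) (\<lambda>(m, t). indicator S m * f (x - m) * \<kappa> (t - m))"
    by simp
  have i: "integrable (lborel \<Otimes>\<^sub>M lborel) (\<lambda>(m, t). indicator S m * f (x - m) * (c t * \<kappa> (t - m)))"
  proof (rule Bochner_Integration.integrable_bound[OF i0])
    show "(\<lambda>(m, t). indicator S m * f (x - m) * (c t * \<kappa> (t - m)))
        \<in> borel_measurable (lborel \<Otimes>\<^sub>M lborel)" by measurable
    show "AE z in lborel \<Otimes>\<^sub>M lborel.
        norm (case z of (m, t) \<Rightarrow> indicator S m * f (x - m) * (c t * \<kappa> (t - m)))
          \<le> norm (case z of (m, t) \<Rightarrow> indicator S m * f (x - m) * \<kappa> (t - m))"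
      by (rule AE_I2) (use c in \<open>auto simp: abs_mult intro!: mult_left_mono mult_left_le_one_le\<close>)
  qed
  have sc: "(\<integral>m. indicator S m * f (x - m) * (c t * \<kappa> (t - m)) \<partial>lborel) = c t * score t x" for t
    unfolding score_def integral_mult_right_zero[symmetric]
    by (rule Bochner_Integration.integral_cong) (auto simp: algebra_simps)
  show "integrable lborel (\<lambda>t. c t * score t x)"
    using lborel_pair.integrable_snd[OF i] by (simp add: sc)
  show "(\<integral>m. indicator S m * f (x - m) * (\<integral>t. c t * \<kappa> (t - m) \<partial>lborel) \<partial>lborel)
          = (\<integral>t. c t * score t x \<partial>lborel)"
    using lborel_pair.Fubini_integral[OF i] by (simp add: sc)
  show "integrable lborel (\<lambda>m. indicator S m * f (x - m) * (\<integral>t. c t * \<kappa> (t - m) \<partial>lborel))"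
    using lborel_pair.integrable_fst[OF i] by simp
qed

lemma score_eq_0_AE:
  assumes "AE m in lborel. indicator S m * f (x - m) = 0"
  shows "score d x = 0"
  unfolding score_def by (rule integral_eq_zero_AE) (use assms in \<open>auto elim!: eventually_mono\<close>)

text \<open>This is what bounds the minimisers when \<open>S\<close> is a half-line. If the score were never positive,
  its integral over \<open>{y<..}\<close>, which is the posterior mean of the nonnegative \<open>tail (y - m)\<close> up to
  normalisation, would vanish for every \<open>y\<close>. As \<open>tail\<close> is positive near \<open>0\<close>, no mass could be
  left anywhere.\<close>

lemma exists_score_pos:
  assumes "score d x < 0"
  obtains d' where "0 < score d' x"
proof (rule ccontr)
  assume "\<not> thesis"
  with that have le: "score t x \<le> 0" for t by (meson not_le)
  obtain e where e: "0 < e" "\<And>t. \<bar>t\<bar> < e \<Longrightarrow> 0 < k t"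
    using even_unimodal_pos_near_0[OF k_nonneg k_mono k_pos] by blast
  have ae: "AE m in lborel. indicator S m * f (x - m) * tail (y - m) = 0" for y
  proof -
    let ?h = "\<lambda>m. indicator S m * f (x - m) * tail (y - m)"
    have "integrable lborel ?h" "(\<integral>m. ?h m \<partial>lborel) = (\<integral>t. indicator {y<..} t * score t x \<partial>lborel)"
      using integral_score[of "indicator {y<..}" x] by (simp_all add: tail_shift_eq)
    moreover have "0 \<le> (\<integral>t. - (indicator {y<..} t * score t x) \<partial>lborel)"
      by (intro integral_nonneg_AE AE_I2) (use le in \<open>simp add: indicator_def\<close>)
    moreover have "0 \<le> ?h m" for m using f_nonneg tail_nonneg by simp
    moreover from this have "0 \<le> (\<integral>m. ?h m \<partial>lborel)" by (intro integral_nonneg_AE AE_I2)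
    ultimately show ?thesis
      using integral_nonneg_eq_0_iff_AE[of lborel ?h] by simp
  qed
  \<comment> \<open>Countably many centres \<open>y\<close>, spaced by \<open>e\<close>, cover the line.\<close>
  then have "AE m in lborel. \<forall>i::int. indicator S m * f (x - m) * tail (e * of_int i - m) = 0"
    by (subst AE_all_countable) auto
  then have "AE m in lborel. indicator S m * f (x - m) = 0"
  proof (rule eventually_mono)
    fix m assume *: "\<forall>i::int. indicator S m * f (x - m) * tail (e * of_int i - m) = 0"
    have "\<bar>e * of_int \<lfloor>m / e\<rfloor> - m\<bar> < e"
    proof -
      have "e * of_int \<lfloor>m / e\<rfloor> \<le> e * (m / e)" "e * (m / e) < e * (of_int \<lfloor>m / e\<rfloor> + 1)"
        using \<open>0 < e\<close> by (intro mult_left_mono mult_strict_left_mono; linarith)+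
      then have "e * of_int \<lfloor>m / e\<rfloor> \<le> m" "m < e * of_int \<lfloor>m / e\<rfloor> + e"
        using \<open>0 < e\<close> by (simp_all add: algebra_simps)
      then show ?thesis by simp
    qed
    then have "0 < tail (e * of_int \<lfloor>m / e\<rfloor> - m)" using e(2) by (intro tail_pos[of e]) auto
    with * show "indicator S m * f (x - m) = 0" by (metis mult_eq_0_iff less_irrefl)
  qed
  from score_eq_0_AE[OF this] assms show False by simp
qed

lemma bdd_descent: "bdd_above (descent x)"
proof (cases "\<exists>d. score d x < 0")
  case True
  then obtain d' where d': "0 < score d' x" using exists_score_pos by blast
  have "y \<le> max a d'" if "y \<in> descent x" for y
    using that score_single_crossing[OF d', of y] by (cases "d' \<le> y") (auto simp: descent_def)
  then show ?thesis by (rule bdd_aboveI)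
next
  case False
  then show ?thesis by (auto simp: descent_def)
qed

lemma \<delta>_ge: "a \<le> \<delta> x"
  unfolding \<delta>_def by (rule cSup_upper[OF _ bdd_descent]) (simp add: descent_def)

lemma less_\<delta>D:
  assumes "d < \<delta> x" and "a \<le> d"
  obtains d' where "d < d'" "score d' x < 0"
proof -
  obtain d' where "d' \<in> descent x" "d < d'"
    using assms less_cSup_iff[OF _ bdd_descent, of x d] by (auto simp: \<delta>_def descent_def)
  with assms that show ?thesis by (auto simp: descent_def)
qed

lemma score_below_\<delta>: "d < \<delta> x \<Longrightarrow> score d x \<le> 0"
  using score_nonpos[of d x] less_\<delta>D[of d x] score_single_crossing[of d x]
  by (metis linear not_le less_imp_le)

lemma score_above_\<delta>:
  assumes "\<delta> x < d"
  shows "0 \<le> score d x"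
proof (rule ccontr)
  assume "\<not> ?thesis"
  then have "d \<in> descent x" using assms \<delta>_ge[of x] by (simp add: descent_def)
  then have "d \<le> \<delta> x" unfolding \<delta>_def by (rule cSup_upper[OF _ bdd_descent])
  with assms show False by simp
qed

lemma between_in_S:
  assumes "d < \<delta> x" and "a < d"
  shows "d \<in> S"
proof -
  obtain d' where d': "d < d'" "score d' x < 0" using less_\<delta>D assms by (metis less_imp_le)
  then obtain m where m: "m \<in> S" "d' < m" using score_nonneg[of d' x] by (meson not_le)
  show ?thesis by (rule S_down[OF m(1)]) (use m d' assms in auto)
qed

text \<open>At a point of descent \<open>d\<close> for \<open>x'\<close>, shifting estimate and observation down by \<open>x' - x\<close> can only
  make the score smaller, so \<open>d - (x' - x)\<close> lies at or below \<open>\<delta> x\<close>.\<close>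

lemma \<delta>_shift_antimono:
  assumes "x \<le> x'"
  shows "\<delta> x' - x' \<le> \<delta> x - x"
proof -
  have "d \<le> \<delta> x + (x' - x)" if "d \<in> descent x'" for d
  proof (rule ccontr)
    assume "\<not> ?thesis"
    then have gt: "\<delta> x < d - (x' - x)" by simp
    with \<delta>_ge[of x] assms that have neg: "score d x' < 0" by (auto simp: descent_def)
    then obtain m where m: "m \<in> S" "d < m" using score_nonneg[of d x'] by (meson not_le)
    have "score (x + (d - x')) x \<le> score (x' + (d - x')) x'"
      by (rule score_shift_mono[OF assms _ m(1)]) (use m gt \<delta>_ge[of x] in auto)
    with neg score_above_\<delta>[OF gt] show False by (simp add: algebra_simps)
  qed
  then have "\<delta> x' \<le> \<delta> x + (x' - x)" unfolding \<delta>_def[of x']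
    by (intro cSup_least) (auto simp: descent_def)
  then show ?thesis by simp
qed

lemma \<delta>_meas [measurable]: "\<delta> \<in> borel_measurable borel"
proof -
  have "mono (\<lambda>x. x - \<delta> x)"
    by (rule monoI) (use \<delta>_shift_antimono in force)
  then have "(\<lambda>x. x - (x - \<delta> x)) \<in> borel_measurable borel"
    by (intro borel_measurable_diff borel_measurable_mono) auto
  then show ?thesis by simp
qed

lemma integrable_S_tail: 
  "integrable lborel (\<lambda>m. indicator S m * f (x - m) * tail (d - m))"
  using integral_score(3)[of "indicator {d<..}" x] by (simp add: tail_shift_eq)

text \<open>Bayes optimality of \<open>\<delta>\<close>, in terms of \<open>tail\<close>, which decreases as the loss increases: the integral of the score
  from \<open>\<delta> x\<close> to \<open>d\<close> is nonnegative for \<open>d\<close> on either side.\<close>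

lemma \<delta>_maximises_tail:
  "(\<integral>m. indicator S m * f (x - m) * tail (d - m) \<partial>lborel)
    \<le> (\<integral>m. indicator S m * f (x - m) * tail (\<delta> x - m) \<partial>lborel)"
proof -
  have "0 \<le> (\<integral>t. (indicator {\<delta> x<..} t - indicator {d<..} t) * score t x \<partial>lborel)"
  proof (intro integral_nonneg_AE)
    show "AE t in lborel. 0 \<le> (indicator {\<delta> x<..} t - indicator {d<..} t) * score t x"
      using AE_lborel_singleton[of "\<delta> x"]
    proof (rule eventually_mono)
      fix t :: real assume "t \<noteq> \<delta> x"
      then consider "t < \<delta> x" | "\<delta> x < t" by linarith
      then show "0 \<le> (indicator {\<delta> x<..} t - indicator {d<..} t) * score t x"
        by cases (use score_below_\<delta>[of t x] score_above_\<delta>[of x t] in \<open>auto simp: indicator_def\<close>)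
    qed
  qed
  also have "\<dots> = (\<integral>m. indicator S m * f (x - m) * (tail (\<delta> x - m) - tail (d - m)) \<partial>lborel)"
    unfolding tail_diff_shift
    by (subst integral_score(2)[symmetric]) (auto simp: indicator_def)
  finally show ?thesis
    using integrable_S_tail by (simp add: right_diff_distrib)
qed


section \<open>Comparison of risks\<close>

text \<open>Let \<open>z\<close> be the end point of the ray. If the sign change \<open>- s\<close> lies left of \<open>z - \<mu>\<close>, only positive
  values of \<open>\<psi> s\<close> are seen. Otherwise take an observation \<open>x\<close> in the ray so close to \<open>z\<close> that
  \<open>x - z + \<mu>\<close> still lies in \<open>S\<close>: the ray then contains all \<open>u\<close> with \<open>\<psi> s u > 0\<close>, and within the ray
  all \<open>u\<close> with \<open>\<psi> s u < 0\<close> belong to the window of \<open>score (x + s) x\<close>. So the score is a lower bound.\<close>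

lemma upper_ray_integral_nonneg:
  assumes "\<mu> \<in> S"
  shows "0 \<le> (\<integral>u. indicator {x. \<delta> x < x + s} (u + \<mu>) * \<psi> s u \<partial>lborel)"
proof -
  define U where "U = {x. \<delta> x < x + s}"
  have up: "x' \<in> U" if "x \<in> U" "x \<le> x'" for x x'
    using that \<delta>_shift_antimono[of x x'] by (simp add: U_def)
  have "x \<in> U \<Longrightarrow> a - s \<le> x" for x using \<delta>_ge[of x] by (simp add: U_def)
  then have bdd: "bdd_below U" by (rule bdd_belowI)
  have U_int: "integrable lborel (\<lambda>u. indicator U (u + \<mu>) * \<psi> s u)"
  proof -
    have "{u. \<delta> (u + \<mu>) < u + \<mu> + s} \<in> sets borel" by measurable
    from \<psi>_indicator_int[OF this] show ?thesis by (simp add: U_def indicator_def)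
  qed
  define z where "z = Inf U"
  have z_le: "z \<le> x" if "x \<in> U" for x unfolding z_def by (rule cInf_lower[OF that bdd])
  have "0 \<le> (\<integral>u. indicator U (u + \<mu>) * \<psi> s u \<partial>lborel)"
  proof (cases "U = {} \<or> - s \<le> z - \<mu>")
    case True
    have "0 \<le> indicator U (u + \<mu>) * \<psi> s u" for u
      using True z_le[of "u + \<mu>"] \<psi>_nonneg[of s u] by (auto simp: indicator_def)
    then show ?thesis by (intro integral_nonneg_AE AE_I2)
  next
    case False
    obtain \<nu> where \<nu>: "\<nu> \<in> S" "\<mu> < \<nu>" using S_up[OF assms] by auto
    have "\<exists>x\<in>U. x < z + (\<nu> - \<mu>)"
      using False \<nu> cInf_less_iff[OF _ bdd, of "z + (\<nu> - \<mu>)"] by (simp add: z_def)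
    then obtain x where x: "x \<in> U" "x < z + (\<nu> - \<mu>)" by auto
    have *: "indicator S (x - u) * \<psi> s u \<le> indicator U (u + \<mu>) * \<psi> s u" for u
    proof (cases "- s < u")
      case True
      then have "\<exists>x\<in>U. x < u + \<mu>"
        using False cInf_less_iff[OF _ bdd, of "u + \<mu>"] by (simp add: z_def)
      then have "u + \<mu> \<in> U" using up by (metis less_imp_le)
      then show ?thesis using \<psi>_nonneg[of s u] True by (auto simp: indicator_def)
    next
      case u: False
      have "x - u \<in> S" if "u + \<mu> \<in> U"
      proof (rule S_down[OF \<nu>(1)])
        show "a < x - u" using x(1) \<delta>_ge[of x] u by (simp add: U_def)
        show "x - u \<le> \<nu>" using x z_le[OF that] by simp
      qed
      then show ?thesis using \<psi>_nonpos[of u s] u by (auto simp: indicator_def)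
    qed
    have "0 \<le> score (x + s) x" using x by (intro score_above_\<delta>) (simp add: U_def)
    also have "\<dots> \<le> (\<integral>u. indicator U (u + \<mu>) * \<psi> s u \<partial>lborel)"
      unfolding score_eq by (rule integral_mono[OF \<psi>_S_int U_int *])
    finally show ?thesis .
  qed
  then show ?thesis by (simp add: U_def)
qed

lemma lower_ray_int:
  "integrable lborel (\<lambda>u. indicator {x. x + s < \<delta> x} (u + \<mu>) * \<psi> s u)"
proof -
  have "{u. u + \<mu> + s < \<delta> (u + \<mu>)} \<in> sets borel" by measurable
  from \<psi>_indicator_int[OF this] show ?thesis by (simp add: indicator_def)
qed

lemma lower_ray_down:
  assumes "x + s < \<delta> x" "x' \<le> x"
  shows "x' + s < \<delta> x'"
  using \<delta>_shift_antimono[OF assms(2)] assms by simp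

text \<open>The pointwise comparison behind the bound for the lower ray, mirroring the one for the upper ray.\<close>

lemma lower_ray_le_score:
  assumes "x + s < \<delta> x" and less: "\<And>u. u < - s \<Longrightarrow> u + \<mu> + s < \<delta> (u + \<mu>)"
    and le: "\<And>u. u + \<mu> + s < \<delta> (u + \<mu>) \<Longrightarrow> u < x - a"
  shows "indicator {x. x + s < \<delta> x} (u + \<mu>) * \<psi> s u \<le> indicator S (x - u) * \<psi> s u"
proof (cases "- s \<le> u")
  case True
  have "x - u \<in> S" if "u + \<mu> + s < \<delta> (u + \<mu>)"
    using between_in_S[of "x - u" x] assms(1) le[OF that] True by simp
  then show ?thesis using \<psi>_nonneg[of s u] True by (auto simp: indicator_def)
next
  case False
  then show ?thesis using less[of u] \<psi>_nonpos[of u s] by (auto simp: indicator_def)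
qed

text \<open>On a half-line the lower ray may be everything, and then it has no end point to compare at. The
  windows of the scores exhaust the line as \<open>x\<close> grows, so the limit of the scores takes over.\<close>

lemma whole_line_integral_nonpos:
  assumes "\<And>x. x + s < \<delta> x"
  shows "(\<integral>u. \<psi> s u \<partial>lborel) \<le> 0"
proof -
  have in_S: "d \<in> S" if "a < d" for d
    using between_in_S[of d "d - s"] assms[of "d - s"] that by simp
  have "(\<lambda>n. \<integral>u. indicator S (real n - u) * \<psi> s u \<partial>lborel) \<longlonglongrightarrow> (\<integral>u. \<psi> s u \<partial>lborel)"
  proof (rule integral_dominated_convergence[where w = "\<lambda>u. \<bar>\<psi> s u\<bar>"])
    show "AE u in lborel. (\<lambda>n. indicator S (real n - u) * \<psi> s u) \<longlonglongrightarrow> \<psi> s u"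
    proof (rule AE_I2)
      fix u
      have "\<forall>\<^sub>F n in sequentially. a + u < real n"
        using filterlim_real_sequentially by (simp add: filterlim_at_top_dense)
      then have "\<forall>\<^sub>F n in sequentially. indicator S (real n - u) * \<psi> s u = \<psi> s u"
        by (rule eventually_mono) (simp add: in_S)
      then show "(\<lambda>n. indicator S (real n - u) * \<psi> s u) \<longlonglongrightarrow> \<psi> s u"
        by (rule tendsto_eventually)
    qed
  qed (use \<psi>_int in \<open>auto simp: indicator_def\<close>)
  moreover have "(\<integral>u. indicator S (real n - u) * \<psi> s u \<partial>lborel) \<le> 0" for n
    using score_below_\<delta>[OF assms[of "real n"]] by (simp add: score_eq)
  ultimately show ?thesis by (intro LIMSEQ_le_const2) auto
qed

lemma lower_ray_integral_nonpos:
  assumes "\<mu> \<in> S"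
  shows "(\<integral>u. indicator {x. x + s < \<delta> x} (u + \<mu>) * \<psi> s u \<partial>lborel) \<le> 0"
proof (cases "bdd_above {x. x + s < \<delta> x}")
  case False
  have all: "x + s < \<delta> x" for x
  proof -
    obtain x' where "x' + s < \<delta> x'" "x < x'" using False by (auto simp: bdd_above_def not_le)
    then show ?thesis using lower_ray_down[of x' s x] by simp
  qed
  then show ?thesis using whole_line_integral_nonpos[of s] by (simp add: indicator_def)
next
  case bdd: True
  define D where "D = {x. x + s < \<delta> x}"
  define z where "z = Sup D"
  have bdd: "bdd_above D" using bdd by (simp add: D_def)
  have le_z: "x \<le> z" if "x \<in> D" for x unfolding z_def by (rule cSup_upper[OF that bdd])
  have "a - s - 1 \<in> D" using \<delta>_ge[of "a - s - 1"] by (simp add: D_def)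
  then have ne: "D \<noteq> {}" by auto
  have D_less: "\<exists>x\<in>D. w < x" if "w < z" for w
    using less_cSup_iff[OF ne bdd] that by (simp add: z_def)
  show ?thesis
  proof (cases "z - \<mu> \<le> - s")
    case True
    have "0 \<le> - (indicator D (u + \<mu>) * \<psi> s u)" for u
      using True le_z[of "u + \<mu>"] \<psi>_nonpos[of u s] by (auto simp: indicator_def)
    then have "0 \<le> (\<integral>u. - (indicator D (u + \<mu>) * \<psi> s u) \<partial>lborel)" by (intro integral_nonneg_AE AE_I2)
    then show ?thesis by (simp add: D_def)
  next
    case False
    obtain x where x: "x \<in> D" "z - (\<mu> - a) < x" using D_less[of "z - (\<mu> - a)"] S_lower[OF assms] by auto
    have "(\<integral>u. indicator D (u + \<mu>) * \<psi> s u \<partial>lborel) \<le> score (x + s) x"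
      unfolding score_eq D_def
    proof (rule integral_mono[OF lower_ray_int \<psi>_S_int lower_ray_le_score])
      show "x + s < \<delta> x" using x by (simp add: D_def)
      show "u + \<mu> + s < \<delta> (u + \<mu>)" if "u < - s" for u
        using D_less[of "u + \<mu>"] that False lower_ray_down[of _ s "u + \<mu>"] by (auto simp: D_def)
      show "u < x - a" if "u + \<mu> + s < \<delta> (u + \<mu>)" for u
        using le_z[of "u + \<mu>"] that x by (simp add: D_def)
    qed
    also have "\<dots> \<le> 0" using x by (intro score_below_\<delta>) (simp add: D_def)
    finally show ?thesis by (simp add: D_def)
  qed
qed

text \<open>Up to null sets in \<open>s\<close>, this is \<open>1\<close> for \<open>\<delta> x - x < s \<le> 0\<close>, \<open>-1\<close> for \<open>0 < s \<le> \<delta> x - x\<close> and \<open>0\<close>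
  otherwise: the difference of the indicators of \<open>{\<delta> x<..}\<close> and \<open>{x<..}\<close> at \<open>x + s\<close>. Strict
  inequalities in both cases make the sign of the score available on both rays.\<close>

definition gain_weight :: "real \<Rightarrow> real \<Rightarrow> real" where
  "gain_weight s x = (if s \<le> 0 then indicator {x. \<delta> x < x + s} x else - indicator {x. x + s < \<delta> x} x)"

text \<open>The contribution of the shift \<open>s\<close> to the decrease in risk.\<close>

definition gain :: "real \<Rightarrow> real \<Rightarrow> real" where
  "gain \<mu> s = (\<integral>u. gain_weight s (u + \<mu>) * \<psi> s u \<partial>lborel)"

lemma gain_nonneg: "\<mu> \<in> S \<Longrightarrow> 0 \<le> gain \<mu> s"
  using upper_ray_integral_nonneg[of \<mu> s] lower_ray_integral_nonpos[of \<mu> s]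
  by (cases "s \<le> 0") (simp_all add: gain_def gain_weight_def)

lemma tail_le: "tail w \<le> (\<integral>t. k t \<partial>lborel)"
  unfolding tail_def
proof (rule integral_mono[OF _ k_int])
  show "integrable lborel (\<lambda>t. indicator {w<..} t * \<kappa> t)" by (rule \<kappa>_indicator_int) simp
  show "indicator {w<..} t * \<kappa> t \<le> k t" for t
    using abs_\<kappa>[of t] k_nonneg[of t] by (auto simp: indicator_def)
qed

lemma f_shift_int: "integrable lborel (\<lambda>x. f (x - \<mu>))"
  using lborel_integrable_real_affine[OF f_int, of 1 "- \<mu>"] by simp

lemma integrable_tail_risk:
  assumes [measurable]: "e \<in> borel_measurable borel"
  shows "integrable lborel (\<lambda>x. f (x - \<mu>) * tail (e x - \<mu>))"
proof (rule Bochner_Integration.integrable_bound)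
  show "integrable lborel (\<lambda>x. f (x - \<mu>) * (\<integral>t. k t \<partial>lborel))" using f_shift_int by simp
  show "AE x in lborel. norm (f (x - \<mu>) * tail (e x - \<mu>)) \<le> norm (f (x - \<mu>) * (\<integral>t. k t \<partial>lborel))"
    using f_nonneg tail_nonneg tail_le k_pos by (auto simp: abs_mult intro!: AE_I2 mult_left_mono)
qed measurable

lemma integral_gain:
  "integrable lborel (gain \<mu>)"
  "(\<integral>x. f (x - \<mu>) * tail (\<delta> x - \<mu>) \<partial>lborel) - (\<integral>x. f (x - \<mu>) * tail (x - \<mu>) \<partial>lborel)
    = (\<integral>s. gain \<mu> s \<partial>lborel)"
proof -
  have i0: "integrable (lborel \<Otimes>\<^sub>M lborel) (\<lambda>(x, s). f (x - \<mu>) * \<kappa> (s + (x - \<mu>)))"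
    by (rule integrable_shear[OF f_shift_int \<kappa>_int]) measurable
  have [measurable]: "(\<lambda>(x, s). gain_weight s x) \<in> borel_measurable (borel \<Otimes>\<^sub>M borel)"
    unfolding gain_weight_def indicator_def mem_Collect_eq by measurable
  have i: "integrable (lborel \<Otimes>\<^sub>M lborel) (\<lambda>(x, s). f (x - \<mu>) * (gain_weight s x * \<kappa> (s + (x - \<mu>))))"
  proof (rule Bochner_Integration.integrable_bound[OF i0])
    show "(\<lambda>(x, s). f (x - \<mu>) * (gain_weight s x * \<kappa> (s + (x - \<mu>))))
        \<in> borel_measurable (lborel \<Otimes>\<^sub>M lborel)" by measurable
    have "\<bar>gain_weight s x\<bar> \<le> 1" for s x by (simp add: gain_weight_def indicator_def)
    then show "AE z in lborel \<Otimes>\<^sub>M lborel.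
        norm (case z of (x, s) \<Rightarrow> f (x - \<mu>) * (gain_weight s x * \<kappa> (s + (x - \<mu>))))
          \<le> norm (case z of (x, s) \<Rightarrow> f (x - \<mu>) * \<kappa> (s + (x - \<mu>)))"
      by (intro AE_I2) (auto simp: abs_mult intro!: mult_left_mono mult_left_le_one_le)
  qed
  have inner_s: "(\<integral>s. f (x - \<mu>) * (gain_weight s x * \<kappa> (s + (x - \<mu>))) \<partial>lborel)
      = f (x - \<mu>) * (tail (\<delta> x - \<mu>) - tail (x - \<mu>))" for x
  proof -
    have "tail (\<delta> x - \<mu>) - tail (x - \<mu>)
        = (\<integral>s. (indicator {\<delta> x<..} (x + s) - indicator {x<..} (x + s)) * \<kappa> (x + s - \<mu>) \<partial>lborel)"
      unfolding tail_diff_shift by (subst lborel_integral_real_affine[where c = 1 and t = x]) simp_all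
    also have "\<dots> = (\<integral>s. gain_weight s x * \<kappa> (s + (x - \<mu>)) \<partial>lborel)"
    proof (rule integral_cong_AE)
      show "AE s in lborel. (indicator {\<delta> x<..} (x + s) - indicator {x<..} (x + s)) * \<kappa> (x + s - \<mu>)
          = gain_weight s x * \<kappa> (s + (x - \<mu>))"
        using AE_lborel_singleton[of "\<delta> x - x"]
        by (rule eventually_mono) (auto simp: gain_weight_def indicator_def algebra_simps)
    qed measurable
    finally show ?thesis by simp
  qed
  have inner_x: "(\<integral>x. f (x - \<mu>) * (gain_weight s x * \<kappa> (s + (x - \<mu>))) \<partial>lborel) = gain \<mu> s" for s
    unfolding gain_def \<psi>_def
    by (subst lborel_integral_real_affine[where c = 1 and t = \<mu>]) (simp_all add: algebra_simps)
  show "integrable lborel (gain \<mu>)"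
    using lborel_pair.integrable_snd[OF i] by (simp add: inner_x)
  show "(\<integral>x. f (x - \<mu>) * tail (\<delta> x - \<mu>) \<partial>lborel) - (\<integral>x. f (x - \<mu>) * tail (x - \<mu>) \<partial>lborel)
    = (\<integral>s. gain \<mu> s \<partial>lborel)"
    using lborel_pair.Fubini_integral[OF i] integrable_tail_risk[of \<delta> \<mu>] integrable_tail_risk[of "\<lambda>x. x" \<mu>]
    unfolding inner_x inner_s by (simp add: right_diff_distrib)
qed

lemma mean_tail_mono:
  assumes "\<mu> \<in> S"
  shows "(\<integral>x. f (x - \<mu>) * tail (x - \<mu>) \<partial>lborel) \<le> (\<integral>x. f (x - \<mu>) * tail (\<delta> x - \<mu>) \<partial>lborel)"
proof -
  have "0 \<le> (\<integral>s. gain \<mu> s \<partial>lborel)" using gain_nonneg[OF assms] by (intro integral_nonneg_AE AE_I2)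
  then show ?thesis using integral_gain(2)[of \<mu>] by simp
qed


section \<open>Strict improvement near the left end point\<close>

text \<open>For \<open>x \<le> a\<close> the posterior density is non-increasing on \<open>S\<close>. Reflection at \<open>d\<close> therefore maps the part of
  \<open>S\<close> right of \<open>d\<close>, which pulls the estimate up, to points of at least the same density, provided that
  the image stays in \<open>S\<close>. The last assumption makes points with image outside \<open>S\<close> irrelevant.\<close>

lemma score_nonneg_reflection:
  assumes "x \<le> a" "a < d" and zero: "k (d - a) = 0 \<or> f (d - x + (d - a)) = 0"
  shows "0 \<le> score d x"
proof -
  define s where "s = d - x"
  define F where "F v = indicator S (d - v) * (\<kappa> v * f (v - s))" for v
  have s: "0 \<le> s" using assms by (simp add: s_def)
  have *: "0 \<le> F v + F (- v)" if v: "0 \<le> v" for v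
  proof (cases "d + v \<in> S \<and> k v \<noteq> 0 \<and> f (v + s) \<noteq> 0")
    case True
    have "v < d - a"
    proof (rule ccontr)
      assume "\<not> ?thesis"
      then have "k v \<le> k (d - a)" "f (v + s) \<le> f (d - x + (d - a))"
        using assms v by (intro k_mono f_mono; simp add: s_def)+
      with zero True k_nonneg[of v] f_nonneg[of "v + s"] show False by auto
    qed
    then have "d - v \<in> S" using S_down[of "d + v" "d - v"] True v by simp
    moreover have "f (v + s) \<le> f (v - s)" using v s by (intro f_mono) auto
    ultimately show ?thesis
      using True \<kappa>_nonneg[OF v] f_even[of "v + s"]
      by (simp add: F_def \<kappa>_odd mult_left_mono)
  next
    case False
    then have "F (- v) = 0" using f_even[of "v + s"] by (auto simp: F_def \<kappa>_odd \<kappa>_def k_even)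
    moreover have "0 \<le> F v" using \<kappa>_nonneg[OF v] f_nonneg by (simp add: F_def)
    ultimately show ?thesis by simp
  qed
  have F_int: "integrable lborel F"
    using lborel_integrable_real_affine[OF \<psi>_S_int[of "d - s" s], of 1 "- s"]
    by (simp add: F_def[abs_def] \<psi>_def algebra_simps)
  have "0 \<le> F v + F (- v)" for v using *[of v] *[of "- v"] by (cases "0 \<le> v") auto
  then have "0 \<le> (\<integral>v. F v + F (- v) \<partial>lborel)" by (intro integral_nonneg_AE AE_I2)
  also have "\<dots> = (\<integral>v. F v \<partial>lborel) + (\<integral>v. F (- v) \<partial>lborel)"
    using F_int lborel_integrable_real_affine[OF F_int, of "-1" 0] by simp
  also have "(\<integral>v. F (- v) \<partial>lborel) = (\<integral>v. F v \<partial>lborel)"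
    by (subst lborel_integral_real_affine[where c = "-1" and t = 0]) simp_all
  finally have "0 \<le> score d (d - s)" unfolding score_eq' by (simp add: F_def)
  then show ?thesis by (simp add: s_def)
qed

lemma k_pos_below_\<delta>:
  assumes "x \<le> a" "0 \<le> v" "v < \<delta> x - a"
  shows "0 < k v"
proof (rule ccontr)
  assume "\<not> 0 < k v"
  obtain d where d: "a + v < d" "score d x < 0" using less_\<delta>D[of "a + v" x] assms by auto
  have "k (d - a) \<le> k v" using d assms by (intro k_mono) simp
  then have "k (d - a) = 0" using \<open>\<not> 0 < k v\<close> k_nonneg[of "d - a"] by simp
  then have "0 \<le> score d x" using d assms by (intro score_nonneg_reflection) auto
  with d show False by simp
qed

text \<open>If \<open>f\<close> vanished beyond \<open>\<delta> a - a\<close>, the posterior at \<open>x = a\<close> would be a non-increasing density on an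
  interval of at most that length, and \<open>\<delta> a\<close> would be at most its midpoint.
  This leaves only a point mass at \<open>0\<close> for \<open>f\<close>, which is no density.\<close>

lemma f_pos_beyond_shift:
  obtains r where "\<delta> a - a < r" "0 < f r"
proof (rule ccontr)
  define g where "g = \<delta> a - a"
  assume "\<not> thesis"
  with that f_nonneg have zero: "f t = 0" if "g < t" for t
    by (metis g_def less_eq_real_def that)
  obtain e where e: "0 < e" "\<And>t. \<bar>t\<bar> < e \<Longrightarrow> 0 < f t"
    using even_unimodal_pos_near_0[OF f_nonneg f_mono f_pos] by blast
  have "0 < g" using e(1) e(2)[of "e / 2"] zero[of "e / 2"] by (cases "0 < g") auto
  \<comment> \<open>Any factor in \<open>[1/2, 1)\<close> would do in place of \<open>3 / 4\<close>: reflection needs \<open>f (2 * (d - a)) = 0\<close>.\<close>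
  then obtain d where d: "a + 3 / 4 * g < d" "score d a < 0"
    using less_\<delta>D[of "a + 3 / 4 * g" a] by (auto simp: g_def field_simps)
  have "0 \<le> score d a" using d \<open>0 < g\<close> by (intro score_nonneg_reflection) (auto intro!: zero)
  with d show False by simp
qed

text \<open>A strict form of \<open>lower_ray_integral_nonpos\<close>, for shifts \<open>s\<close> that \<open>\<delta> x - x\<close> exceeds only
  at observations \<open>x \<le> a\<close>. Then the end point \<open>z\<close> of the ray lies in \<open>[a - s, a]\<close>. If \<open>\<psi> s\<close> is
  nonpositive on the ray, it is negative next to the end point, as \<open>\<mu>\<close> is close to \<open>a\<close>. Otherwise the
  window of the score extends beyond the ray by an interval of positive length, on which \<open>\<psi> s\<close> is positive.\<close>

lemma gain_pos:
  assumes \<mu>: "\<mu> \<in> S" and "0 < s" and r: "0 < f r" "s + (\<mu> - a) < r"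
    and e: "\<And>t. \<bar>t\<bar> < e \<Longrightarrow> 0 < k t" "\<mu> - a < e"
    and le_a: "\<And>x. x + s < \<delta> x \<Longrightarrow> x \<le> a"
  shows "0 < gain \<mu> s"
proof -
  define D where "D = {x. x + s < \<delta> x}"
  define z where "z = Sup D"
  have bdd: "bdd_above D" using le_a by (intro bdd_aboveI[of _ a]) (simp add: D_def)
  have le_z: "x \<le> z" if "x \<in> D" for x unfolding z_def by (rule cSup_upper[OF that bdd])
  have z_ge: "a - s \<le> z"
  proof (rule field_le_epsilon)
    fix t :: real assume "0 < t"
    then have "a - s - t \<in> D" using \<delta>_ge[of "a - s - t"] by (simp add: D_def)
    then show "a - s \<le> z + t" using le_z by force
  qed
  have "a - s - 1 \<in> D" using \<delta>_ge[of "a - s - 1"] by (simp add: D_def)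
  then have ne: "D \<noteq> {}" by auto
  have D_less: "\<exists>x\<in>D. w < x" if "w < z" for w
    using less_cSup_iff[OF ne bdd] that by (simp add: z_def)
  have f_pos_r: "0 < f u" if "\<bar>u\<bar> \<le> r" for u
    using r f_mono[of u r] that by (auto intro: less_le_trans)
  have a\<mu>: "a < \<mu>" using S_lower[OF \<mu>] .
  have "(\<integral>u. indicator D (u + \<mu>) * \<psi> s u \<partial>lborel) < 0"
  proof (cases "z - \<mu> \<le> - s")
    case True
    have "(\<integral>u. indicator D (u + \<mu>) * \<psi> s u \<partial>lborel) < (\<integral>u. 0 \<partial>(lborel :: real measure))"
    proof (rule integral_less_on_interval[where l = "max (- r) (- s - e)" and r = "z - \<mu>"])
      show "integrable lborel (\<lambda>u. indicator D (u + \<mu>) * \<psi> s u)"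
        using lower_ray_int by (simp add: D_def)
      show "indicator D (u + \<mu>) * \<psi> s u \<le> 0" for u
        using True le_z[of "u + \<mu>"] \<psi>_nonpos[of u s] by (auto simp: indicator_def)
      show "max (- r) (- s - e) < z - \<mu>" using z_ge r e by simp
      fix u assume u: "max (- r) (- s - e) < u" "u < z - \<mu>"
      then have "u + \<mu> \<in> D"
        using D_less[of "u + \<mu>"] lower_ray_down[of _ s "u + \<mu>"] by (auto simp: D_def)
      moreover have "0 < f u" using u True r \<open>0 < s\<close> a\<mu> by (intro f_pos_r) auto
      moreover have "\<kappa> (u + s) < 0" using e(1)[of "u + s"] u True by (simp add: \<kappa>_def)
      ultimately show "indicator D (u + \<mu>) * \<psi> s u < 0" by (simp add: \<psi>_def mult_neg_pos)
    qed simp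
    then show ?thesis by simp
  next
    case False
    obtain x where x: "x \<in> D" "z - (\<mu> - a) < x" using D_less[of "z - (\<mu> - a)"] a\<mu> by auto
    have x': "x + s < \<delta> x" "x \<le> a" using x le_a by (auto simp: D_def)
    have "(\<integral>u. indicator D (u + \<mu>) * \<psi> s u \<partial>lborel) < score (x + s) x"
      unfolding score_eq
    proof (rule integral_less_on_interval[where l = "z - \<mu>" and r = "x - a"])
      show "integrable lborel (\<lambda>u. indicator D (u + \<mu>) * \<psi> s u)"
        using lower_ray_int by (simp add: D_def)
      show "indicator D (u + \<mu>) * \<psi> s u \<le> indicator S (x - u) * \<psi> s u" for u
        unfolding D_def
      proof (rule lower_ray_le_score[OF x'(1)])
        show "u + \<mu> + s < \<delta> (u + \<mu>)" if "u < - s" for u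
          using D_less[of "u + \<mu>"] that False lower_ray_down[of _ s "u + \<mu>"] by (auto simp: D_def)
        show "u < x - a" if "u + \<mu> + s < \<delta> (u + \<mu>)" for u
          using le_z[of "u + \<mu>"] that x by (simp add: D_def)
      qed
      fix u assume u: "z - \<mu> < u" "u < x - a"
      then have "u + \<mu> \<notin> D" using le_z[of "u + \<mu>"] by auto
      moreover have "x - u \<in> S" using between_in_S[of "x - u" x] u x' False by simp
      moreover have "0 < f u" using u x' False r a\<mu> by (intro f_pos_r) auto
      moreover have "0 < \<kappa> (u + s)"
        using k_pos_below_\<delta>[of x "u + s"] u x' False by (simp add: \<kappa>_def)
      ultimately show "indicator D (u + \<mu>) * \<psi> s u < indicator S (x - u) * \<psi> s u"
        by (simp add: \<psi>_def)
    qed (use x \<psi>_S_int in auto)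
    also have "\<dots> \<le> 0" using x' by (intro score_below_\<delta>)
    finally show ?thesis .
  qed
  then show ?thesis using \<open>0 < s\<close> by (simp add: gain_def gain_weight_def D_def)
qed

text \<open>The gain is nonnegative for all \<open>s\<close> and positive for \<open>s\<close> between \<open>\<delta> a - a\<close> and the midpoint of
  \<open>\<delta> a - a\<close> and \<open>r\<close>, which leaves room for \<open>s + (\<mu> - a) < r\<close>.\<close>

lemma mean_tail_strict:
  "\<exists>\<mu>\<in>S. (\<integral>x. f (x - \<mu>) * tail (x - \<mu>) \<partial>lborel) < (\<integral>x. f (x - \<mu>) * tail (\<delta> x - \<mu>) \<partial>lborel)"
proof -
  obtain r where r: "\<delta> a - a < r" "0 < f r" by (rule f_pos_beyond_shift)
  obtain e where e: "0 < e" "\<And>t. \<bar>t\<bar> < e \<Longrightarrow> 0 < k t"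
    using even_unimodal_pos_near_0[OF k_nonneg k_mono k_pos] by blast
  define g where "g = \<delta> a - a"
  define h where "h = min (e / 2) ((r - g) / 2)"
  have h: "0 < h" "h < e" using r e by (auto simp: h_def g_def)
  have h_le: "h \<le> (r - g) / 2" by (simp only: h_def min.cobounded2)
  obtain m where m: "m \<in> S" using S_nonempty by auto
  define \<mu> where "\<mu> = min m (a + h)"
  have \<mu>: "\<mu> \<in> S" "\<mu> - a \<le> h"
    using S_down[OF m, of \<mu>] S_lower[OF m] h by (auto simp: \<mu>_def)
  have "(\<integral>s. 0 \<partial>(lborel :: real measure)) < (\<integral>s. gain \<mu> s \<partial>lborel)"
  proof (rule integral_less_on_interval[where l = g and r = "(g + r) / 2"])
    fix s assume s: "g < s" "s < (g + r) / 2"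
    show "0 < gain \<mu> s"
    proof (rule gain_pos[of \<mu> s r e])
      show "0 < s" using s \<delta>_ge[of a] by (simp add: g_def)
      have "s + (\<mu> - a) < (g + r) / 2 + (r - g) / 2" using s \<mu> h_le by linarith
      then show "s + (\<mu> - a) < r" by (simp add: field_simps)
      show "\<mu> - a < e" using \<mu> h by simp
      show "x \<le> a" if "x + s < \<delta> x" for x
        using \<delta>_shift_antimono[of a x] that s by (cases "x \<le> a") (auto simp: g_def)
    qed (use \<mu>(1) r(2) e(2) in auto)
  qed (use gain_nonneg[OF \<mu>(1)] integral_gain(1) r in \<open>auto simp: g_def\<close>)
  then show ?thesis using integral_gain(2)[of \<mu>] \<mu>(1) by (intro bexI[of _ \<mu>]) auto
qed

end

section \<open>Symmetric location densities\<close>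

text \<open>The points \<open>y\<close> and \<open>x + w - y\<close> are convex combinations of \<open>x\<close> and \<open>w\<close> with exchanged weights, so
  adding the two concavity inequalities for \<open>ln \<circ> f\<close> recovers each end point once.\<close>

lemma logconcave_exchange:
  assumes lc: "logconcave f" and nonneg: "\<And>t. 0 \<le> f t" and "x \<le> y" "y \<le> w"
  shows "f x * f w \<le> f y * f (x + w - y)"
proof (cases "f x = 0 \<or> f w = 0 \<or> x = w")
  case True
  then show ?thesis using assms by (auto simp: nonneg)
next
  case False
  have conc: "concave_on {t. 0 < f t} (\<lambda>t. ln (f t))" using lc by (simp add: logconcave_def)
  then have conv: "convex {t. 0 < f t}" by (rule concave_on_imp_convex)
  have xw: "x \<in> {t. 0 < f t}" "w \<in> {t. 0 < f t}"
    using False nonneg[of x] nonneg[of w] by (auto simp: less_eq_real_def)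
  define t where "t = (y - x) / (w - x)"
  have t: "0 \<le> t" "t \<le> 1" using assms False by (auto simp: t_def field_simps)
  have "t * (w - x) = y - x" using False assms by (simp add: t_def)
  then have y: "(1 - t) *\<^sub>R x + t *\<^sub>R w = y" "(1 - (1 - t)) *\<^sub>R x + (1 - t) *\<^sub>R w = x + w - y"
    by (simp_all add: algebra_simps)
  have "y \<in> {t. 0 < f t}" "x + w - y \<in> {t. 0 < f t}"
    using convexD_alt[OF conv xw, of t] convexD_alt[OF conv xw, of "1 - t"] t unfolding y by auto
  moreover have "(1 - t) * ln (f x) + t * ln (f w) \<le> ln (f y)"
    "(1 - (1 - t)) * ln (f x) + (1 - t) * ln (f w) \<le> ln (f (x + w - y))"
    using concave_onD[OF conc, of t x w] concave_onD[OF conc, of "1 - t" x w] t xw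
    unfolding y by auto
  ultimately have pos: "0 < f x" "0 < f w" "0 < f y" "0 < f (x + w - y)"
    and "ln (f x) + ln (f w) \<le> ln (f y) + ln (f (x + w - y))"
    using xw by (auto simp: algebra_simps)
  then have "ln (f x * f w) \<le> ln (f y * f (x + w - y))" by (simp add: ln_mult)
  then show ?thesis using pos by simp
qed

text \<open>Apply the exchange inequality to \<open>y\<close> and \<open>- y\<close>, which lie between \<open>- \<bar>z\<bar>\<close> and \<open>\<bar>z\<bar>\<close>.\<close>

lemma logconcave_even_unimodal:
  assumes lc: "logconcave (\<lambda>t. p (t\<^sup>2))" and nonneg: "\<And>t. 0 \<le> p (t\<^sup>2)" and "\<bar>y\<bar> \<le> \<bar>z :: real\<bar>"
  shows "p (z\<^sup>2) \<le> p (y\<^sup>2)"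
proof -
  have "p ((- \<bar>z\<bar>)\<^sup>2) * p (\<bar>z\<bar>\<^sup>2) \<le> p (y\<^sup>2) * p ((- \<bar>z\<bar> + \<bar>z\<bar> - y)\<^sup>2)"
    by (rule logconcave_exchange[OF lc nonneg]) (use assms in auto)
  then have "(p (z\<^sup>2))\<^sup>2 \<le> (p (y\<^sup>2))\<^sup>2" by (simp add: power2_eq_square)
  then show ?thesis using nonneg by (rule power2_le_imp_le)
qed

lemma symmetric_density_integrable:
  assumes "symmetric_density q"
  shows "integrable lborel (\<lambda>t. q (t\<^sup>2))" "(\<integral>t. q (t\<^sup>2) \<partial>lborel) = 1"
proof -
  have *: "(\<lambda>t. q (t\<^sup>2)) \<in> borel_measurable lborel" "\<And>t. 0 \<le> q (t\<^sup>2)"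
    "(\<integral>\<^sup>+ t. ennreal (q (t\<^sup>2)) \<partial>lborel) = 1"
    using assms by (auto simp: symmetric_density_def)
  show "integrable lborel (\<lambda>t. q (t\<^sup>2))"
    by (rule integrableI_nonneg) (use * in auto)
  show "(\<integral>t. q (t\<^sup>2) \<partial>lborel) = 1"
    by (subst integral_eq_nn_integral) (use * in auto)
qed

lemma cdf_location_measure:
  assumes "symmetric_density q"
  shows "cdf (location_measure q 0) c = (\<integral>t. indicator {..c} t * q (t\<^sup>2) \<partial>lborel)"
proof -
  have q: "(\<lambda>t. q (t\<^sup>2)) \<in> borel_measurable lborel" "\<And>t. 0 \<le> q (t\<^sup>2)"
    using assms by (auto simp: symmetric_density_def)
  have int: "integrable lborel (\<lambda>t. indicator {..c} t * q (t\<^sup>2))"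
    using integrable_mult_indicator[OF _ symmetric_density_integrable(1)[OF assms], of "{..c}"] by simp
  have "emeasure (location_measure q 0) {..c} = (\<integral>\<^sup>+ t. ennreal (indicator {..c} t * q (t\<^sup>2)) \<partial>lborel)"
    unfolding location_measure_def
    by (subst emeasure_density) (use q in \<open>auto intro!: nn_integral_cong simp: indicator_def\<close>)
  also have "\<dots> = ennreal (\<integral>t. indicator {..c} t * q (t\<^sup>2) \<partial>lborel)"
    by (rule nn_integral_eq_integral[OF int]) (use q in auto)
  finally show ?thesis
    using q by (simp add: cdf_def measure_def integral_nonneg_AE)
qed

lemma cdf_location_measure_minus:
  assumes "symmetric_density q"
  shows "cdf (location_measure q 0) (- c) = 1 - cdf (location_measure q 0) c"
proof -
  note q = symmetric_density_integrable[OF assms]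
  have int: "integrable lborel (\<lambda>t. indicator {..c} t * q (t\<^sup>2))"
    using integrable_mult_indicator[OF _ q(1), of "{..c}"] by simp
  have "cdf (location_measure q 0) (- c) = (\<integral>t. indicator {..- c} (- t) * q (t\<^sup>2) \<partial>lborel)"
    unfolding cdf_location_measure[OF assms]
    by (subst lborel_integral_real_affine[where c = "-1" and t = 0]) simp_all
  also have "\<dots> = (\<integral>t. q (t\<^sup>2) - indicator {..c} t * q (t\<^sup>2) \<partial>lborel)"
    by (rule integral_cong_AE)
       (use AE_lborel_singleton[of c] q(1) in \<open>auto simp: indicator_def elim!: eventually_mono\<close>)
  finally show ?thesis using q int by (simp add: cdf_location_measure[OF assms])
qed

text \<open>By unimodality, the location density with the nearer centre is the larger one, so the absolute
  difference changes form only at the midpoint \<open>m\<close>. Both densities have total mass one, hence the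
  mass of the difference left of \<open>m\<close> equals that of its negative right of \<open>m\<close>.\<close>

lemma L1_loss_location:
  assumes q: "symmetric_density q" and uni: "unimodal_symmetric q"
  shows "L1_loss q \<mu> (\<lambda>y. q (\<bar>y - d\<bar>\<^sup>2)) = ennreal (2 * dual_loss q d \<mu>) \<and> 0 \<le> dual_loss q d \<mu>"
proof (induction \<mu> d rule: linorder_wlog)
  case (sym \<mu> d)
  then show ?case by (simp add: L1_loss_def dual_loss_def abs_minus_commute)
next
  case (le \<mu> d)
  define m where "m = (\<mu> + d) / 2"
  let ?F = "cdf (location_measure q 0)"
  have h_int: "integrable lborel (\<lambda>y. q ((y - c)\<^sup>2))" "(\<integral>y. q ((y - c)\<^sup>2) \<partial>lborel) = 1" for c
    using symmetric_density_integrable[OF q] lborel_integrable_real_affine[of "\<lambda>t. q (t\<^sup>2)" 1 "- c"]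
      lborel_integral_real_affine[of 1 "\<lambda>t. q (t\<^sup>2)" "- c"] by simp_all
  have hm_int: "integrable lborel (\<lambda>y. indicator {..m} y * q ((y - c)\<^sup>2))" for c
    using integrable_mult_indicator[OF _ h_int(1), of "{..m}"] by simp
  have hm: "(\<integral>y. indicator {..m} y * q ((y - c)\<^sup>2) \<partial>lborel) = ?F (m - c)" for c
    unfolding cdf_location_measure[OF q]
    by (subst lborel_integral_real_affine[where c = 1 and t = "- c"]) (simp_all add: indicator_def algebra_simps)
  have split: "\<bar>q ((y - \<mu>)\<^sup>2) - q ((y - d)\<^sup>2)\<bar>
      = 2 * (indicator {..m} y * q ((y - \<mu>)\<^sup>2) - indicator {..m} y * q ((y - d)\<^sup>2))
        - (q ((y - \<mu>)\<^sup>2) - q ((y - d)\<^sup>2))" for y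
  proof (cases "y \<le> m")
    case True
    then have "\<bar>y - \<mu>\<bar> \<le> \<bar>y - d\<bar>" using le by (auto simp: m_def abs_if)
    then have "q ((y - d)\<^sup>2) \<le> q ((y - \<mu>)\<^sup>2)" using uni by (simp add: unimodal_symmetric_def)
    then show ?thesis using True by simp
  next
    case False
    then have "\<bar>y - d\<bar> \<le> \<bar>y - \<mu>\<bar>" using le by (auto simp: m_def abs_if)
    then have "q ((y - \<mu>)\<^sup>2) \<le> q ((y - d)\<^sup>2)" using uni by (simp add: unimodal_symmetric_def)
    then show ?thesis using False by simp
  qed
  have "(\<integral>y. \<bar>q ((y - \<mu>)\<^sup>2) - q ((y - d)\<^sup>2)\<bar> \<partial>lborel) = 2 * (?F (m - \<mu>) - ?F (m - d))"
    unfolding split using h_int hm_int by (simp add: hm)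
  moreover have m: "m - \<mu> = \<bar>d - \<mu>\<bar> / 2" "m - d = - (\<bar>d - \<mu>\<bar> / 2)"
    using le by (simp_all add: m_def field_simps)
  ultimately have "(\<integral>y. \<bar>q ((y - \<mu>)\<^sup>2) - q ((y - d)\<^sup>2)\<bar> \<partial>lborel) = 2 * dual_loss q d \<mu>"
    unfolding m cdf_location_measure_minus[OF q] by (simp add: dual_loss_def)
  moreover have "0 \<le> (\<integral>y. \<bar>q ((y - \<mu>)\<^sup>2) - q ((y - d)\<^sup>2)\<bar> \<partial>lborel)" by simp
  moreover have "L1_loss q \<mu> (\<lambda>y. q (\<bar>y - d\<bar>\<^sup>2)) = ennreal (\<integral>y. \<bar>q ((y - \<mu>)\<^sup>2) - q ((y - d)\<^sup>2)\<bar> \<partial>lborel)"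
    unfolding L1_loss_def power2_abs
    by (rule nn_integral_eq_integral) (use h_int in auto)
  ultimately show ?case by simp
qed

section \<open>Plug-in densities over a restricted parameter space\<close>

locale restricted_density_estimation =
  fixes q p :: "real \<Rightarrow> real" and a b :: real and S :: "real set"
  assumes q: "symmetric_density q" "unimodal_symmetric q"
    and p: "symmetric_density p" "logconcave (\<lambda>t. p (t\<^sup>2))"
    and ab: "a < b" and S: "S = {a<..<b} \<or> S = {a<..}"
begin

lemma p_nonneg: "0 \<le> p (t\<^sup>2)"
  using p by (simp add: symmetric_density_def)

lemma k_int: "integrable lborel (\<lambda>t. q ((t / 2)\<^sup>2))" "(\<integral>t. q ((t / 2)\<^sup>2) \<partial>lborel) = 2"
  using symmetric_density_integrable[OF q(1)] lborel_integrable_real_affine[of "\<lambda>t. q (t\<^sup>2)" "1 / 2" 0]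
    lborel_integral_real_affine[of "1 / 2" "\<lambda>t. q (t\<^sup>2)" 0] by simp_all

sublocale restricted_location "\<lambda>t. q ((t / 2)\<^sup>2)" "\<lambda>t. p (t\<^sup>2)" S a
proof
  show "0 \<le> q ((t / 2)\<^sup>2)" for t
    using q by (simp add: symmetric_density_def)
  show "q ((z / 2)\<^sup>2) \<le> q ((y / 2)\<^sup>2)" if "\<bar>y\<bar> \<le> \<bar>z\<bar>" for y z
    using q(2) that by (simp add: unimodal_symmetric_def)
  show "p (z\<^sup>2) \<le> p (y\<^sup>2)" if "\<bar>y\<bar> \<le> \<bar>z\<bar>" for y z
    using logconcave_even_unimodal[OF p(2) p_nonneg that] .
  show "p (x\<^sup>2) * p (w\<^sup>2) \<le> p (y\<^sup>2) * p ((x + w - y)\<^sup>2)" if "x \<le> y" "y \<le> w" for x y w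
    using logconcave_exchange[OF p(2) p_nonneg that] .
  show "S \<noteq> {}" using S ab by (metis dense greaterThanLessThan_iff greaterThan_iff empty_iff)
  show "\<exists>n\<in>S. m < n" if "m \<in> S" for m
  proof (cases "S = {a<..}")
    case True
    then show ?thesis using that by (intro bexI[of _ "m + 1"]) auto
  next
    case False
    then show ?thesis using S that by (intro bexI[of _ "(m + b) / 2"]) auto
  qed
qed (use S k_int symmetric_density_integrable[OF p(1)] p_nonneg in auto)

text \<open>The factor \<open>1 / 2\<close> in the argument of the distribution function is why \<open>k t = q ((t / 2)\<^sup>2)\<close>.\<close>

lemma dual_loss_tail: "dual_loss q d \<mu> = 1 - tail (d - \<mu>)"
proof -
  let ?w = "\<bar>d - \<mu>\<bar>"
  have int: "integrable lborel (\<lambda>t. indicator {..?w / 2} t * q (t\<^sup>2))"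
    using integrable_mult_indicator[OF _ symmetric_density_integrable(1)[OF q(1)], of "{..?w / 2}"] by simp
  have "tail ?w = (\<integral>t. indicator {?w<..} t * q ((t / 2)\<^sup>2) \<partial>lborel)"
    unfolding tail_def
    by (rule Bochner_Integration.integral_cong) (auto simp: \<kappa>_def indicator_def)
  also have "\<dots> = 2 * (\<integral>t. q (t\<^sup>2) - indicator {..?w / 2} t * q (t\<^sup>2) \<partial>lborel)"
    by (subst lborel_integral_real_affine[where c = 2 and t = 0])
       (auto simp: indicator_def intro!: Bochner_Integration.integral_cong)
  also have "\<dots> = 2 * (1 - cdf (location_measure q 0) (?w / 2))"
    using symmetric_density_integrable[OF q(1)] int by (simp add: cdf_location_measure[OF q(1)])
  finally show ?thesis by (simp add: dual_loss_def tail_abs)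
qed

lemma posterior_loss_tail:
  assumes "0 < marginal p S x"
  shows "posterior_loss q p S x d
    = 1 - (\<integral>m. indicator S m * p ((x - m)\<^sup>2) * tail (d - m) \<partial>lborel) / marginal p S x"
proof -
  have marg: "marginal p S x = (\<integral>m. indicator S m * p ((x - m)\<^sup>2) \<partial>lborel)"
    by (simp add: marginal_def set_lebesgue_integral_def)
  then have int: "integrable lborel (\<lambda>m. indicator S m * p ((x - m)\<^sup>2))"
    using assms not_integrable_integral_eq by fastforce
  have [measurable]: "(\<lambda>m. p ((x - m)\<^sup>2)) \<in> borel_measurable borel"
    using measurable_compose[OF _ f_meas, of "\<lambda>m. x - m" borel] by simp
  have "posterior_loss q p S x d
      = (\<integral>m. indicator S m * p ((x - m)\<^sup>2) / marginal p S x * (1 - tail (d - m)) \<partial>lborel)"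
    unfolding posterior_loss_def posterior_def dual_loss_tail power2_abs
    by (subst integral_density) (use assms p_nonneg in auto)
  also have "\<dots> = (\<integral>m. (indicator S m * p ((x - m)\<^sup>2) - indicator S m * p ((x - m)\<^sup>2) * tail (d - m))
      / marginal p S x \<partial>lborel)"
    by (rule Bochner_Integration.integral_cong) (auto simp: field_simps)
  also have "\<dots> = 1 - (\<integral>m. indicator S m * p ((x - m)\<^sup>2) * tail (d - m) \<partial>lborel) / marginal p S x"
    using int integrable_S_tail[of x d] assms by (simp add: marg diff_divide_distrib)
  finally show ?thesis .
qed

lemma bayes_estimator_\<delta>: "bayes_estimator q p S \<delta>"
  unfolding bayes_estimator_def
  using \<delta>_maximises_tail by (auto simp: posterior_loss_tail divide_right_mono)

lemma L1_risk_plug_in: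
  assumes [measurable]: "e \<in> borel_measurable borel"
  shows "L1_risk q p (plug_in q e) \<mu>
    = ennreal (2 * (1 - (\<integral>x. p ((x - \<mu>)\<^sup>2) * tail (e x - \<mu>) \<partial>lborel)))"
    and "(\<integral>x. p ((x - \<mu>)\<^sup>2) * tail (e x - \<mu>) \<partial>lborel) \<le> 1"
proof -
  let ?R = "\<lambda>x. p ((x - \<mu>)\<^sup>2) - p ((x - \<mu>)\<^sup>2) * tail (e x - \<mu>)"
  have [measurable]: "(\<lambda>x. p ((x - \<mu>)\<^sup>2)) \<in> borel_measurable borel"
    using measurable_compose[OF _ f_meas, of "\<lambda>x. x - \<mu>" borel] by simp
  have loss: "L1_loss q \<mu> (plug_in q e x) = ennreal (2 * (1 - tail (e x - \<mu>)))"
    and le1: "0 \<le> 1 - tail (e x - \<mu>)" for x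
    using L1_loss_location[OF q, of \<mu> "e x"] unfolding dual_loss_tail by (auto simp: plug_in_def[abs_def])
  have "0 \<le> p ((x - \<mu>)\<^sup>2) * (1 - tail (e x - \<mu>))" for x using p_nonneg le1 by simp
  then have nonneg: "0 \<le> ?R x" for x by (simp add: right_diff_distrib)
  have int: "integrable lborel (\<lambda>x. 2 * ?R x)"
    using f_shift_int integrable_tail_risk[OF assms] by simp
  have one: "(\<integral>x. p ((x - \<mu>)\<^sup>2) \<partial>lborel) = 1"
    using symmetric_density_integrable(2)[OF p(1)] lborel_integral_real_affine[of 1 "\<lambda>t. p (t\<^sup>2)" "- \<mu>"]
    by simp
  have R: "(\<integral>x. ?R x \<partial>lborel) = 1 - (\<integral>x. p ((x - \<mu>)\<^sup>2) * tail (e x - \<mu>) \<partial>lborel)"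
    using f_shift_int integrable_tail_risk[OF assms] one by simp
  have "L1_risk q p (plug_in q e) \<mu> = (\<integral>\<^sup>+ x. ennreal (2 * ?R x) \<partial>lborel)"
    unfolding L1_risk_def loss location_measure_def power2_abs
    by (subst nn_integral_density)
       (use p_nonneg le1 in \<open>auto intro!: nn_integral_cong simp: ennreal_mult'[symmetric] algebra_simps\<close>)
  also have "\<dots> = ennreal (\<integral>x. 2 * ?R x \<partial>lborel)"
    by (rule nn_integral_eq_integral[OF int]) (use nonneg in auto)
  finally show "L1_risk q p (plug_in q e) \<mu>
    = ennreal (2 * (1 - (\<integral>x. p ((x - \<mu>)\<^sup>2) * tail (e x - \<mu>) \<partial>lborel)))"
    by (simp only: integral_mult_right_zero R)
  have "0 \<le> (\<integral>x. ?R x \<partial>lborel)" using nonneg by (intro integral_nonneg_AE AE_I2)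
  then show "(\<integral>x. p ((x - \<mu>)\<^sup>2) * tail (e x - \<mu>) \<partial>lborel) \<le> 1" by (simp add: R)
qed

lemma dominates_\<delta>: "dominates q p S (plug_in q \<delta>) (plug_in q (\<lambda>x. x))"
proof -
  have "L1_risk q p (plug_in q \<delta>) \<mu> \<le> L1_risk q p (plug_in q (\<lambda>x. x)) \<mu>" if "\<mu> \<in> S" for \<mu>
    using mean_tail_mono[OF that] by (simp add: L1_risk_plug_in ennreal_leI)
  moreover obtain \<mu> where "\<mu> \<in> S"
    "(\<integral>x. p ((x - \<mu>)\<^sup>2) * tail (x - \<mu>) \<partial>lborel) < (\<integral>x. p ((x - \<mu>)\<^sup>2) * tail (\<delta> x - \<mu>) \<partial>lborel)"
    using mean_tail_strict by auto
  then have "\<exists>\<mu>\<in>S. L1_risk q p (plug_in q \<delta>) \<mu> < L1_risk q p (plug_in q (\<lambda>x. x)) \<mu>"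
    using L1_risk_plug_in(2)[of \<delta> \<mu>]
    by (intro bexI[of _ \<mu>]) (auto simp: L1_risk_plug_in(1) intro!: ennreal_lessI)
  ultimately show ?thesis by (simp add: dominates_def)
qed

text \<open>Parameters in \<open>S\<close> on the side of \<open>\<mu>\<close> that faces \<open>x\<close> are closer to \<open>x\<close>, hence at least as likely as
  \<open>\<mu>\<close> by unimodality. For \<open>x \<noteq> \<mu>\<close> they fill an interval.\<close>

lemma marginal_pos:
  assumes \<mu>: "\<mu> \<in> S" and px: "p ((x - \<mu>)\<^sup>2) \<noteq> 0" and "x \<noteq> \<mu>"
  shows "0 < marginal p S x"
proof -
  obtain \<nu> where \<nu>: "\<nu> \<in> S" "\<mu> < \<nu>" using S_up[OF \<mu>] by auto
  obtain l r where lr: "l < r" "\<And>m. l < m \<Longrightarrow> m < r \<Longrightarrow> m \<in> S \<and> \<bar>x - m\<bar> \<le> \<bar>x - \<mu>\<bar>"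
  proof (cases "\<mu> < x")
    case True
    show ?thesis
      by (rule that[of \<mu> "min x \<nu>"])
         (use True \<nu> S_lower[OF \<mu>] in \<open>auto intro: S_down[OF \<nu>(1)]\<close>)
  next
    case False
    show ?thesis
      by (rule that[of "max a x" \<mu>])
         (use False \<open>x \<noteq> \<mu>\<close> S_lower[OF \<mu>] in \<open>auto intro: S_down[OF \<mu>]\<close>)
  qed
  have "(\<integral>m. 0 \<partial>(lborel :: real measure)) < (\<integral>m. indicator S m * p ((x - m)\<^sup>2) \<partial>lborel)"
  proof (rule integral_less_on_interval[OF _ _ _ lr(1)])
    have "integrable lborel (\<lambda>m. p ((x - m)\<^sup>2))"
      using lborel_integrable_real_affine[OF f_int, of "-1" x] by simp
    then show "integrable lborel (\<lambda>m. indicator S m * p ((x - m)\<^sup>2))"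
      using integrable_mult_indicator[of S lborel "\<lambda>m. p ((x - m)\<^sup>2)"] by simp
    show "0 < indicator S m * p ((x - m)\<^sup>2)" if "l < m" "m < r" for m
      using lr(2)[OF that] f_mono[of "x - m" "x - \<mu>"] px p_nonneg[of "x - \<mu>"] by simp
  qed (use p_nonneg in auto)
  then show ?thesis by (simp add: marginal_def set_lebesgue_integral_def)
qed

lemma L1_risk_cong_AE:
  assumes [measurable]: "e \<in> borel_measurable borel" "e' \<in> borel_measurable borel"
    and eq: "AE x in lborel. 0 < marginal p S x \<longrightarrow> e x = e' x" and "\<mu> \<in> S"
  shows "L1_risk q p (plug_in q e) \<mu> = L1_risk q p (plug_in q e') \<mu>"
proof -
  have [measurable]: "(\<lambda>x. p ((x - \<mu>)\<^sup>2)) \<in> borel_measurable borel"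
    using measurable_compose[OF _ f_meas, of "\<lambda>x. x - \<mu>" borel] by simp
  have "AE x in lborel. p ((x - \<mu>)\<^sup>2) * tail (e x - \<mu>) = p ((x - \<mu>)\<^sup>2) * tail (e' x - \<mu>)"
    using eq AE_lborel_singleton[of \<mu>]
    by eventually_elim (use marginal_pos[OF \<open>\<mu> \<in> S\<close>] in auto)
  then have "(\<integral>x. p ((x - \<mu>)\<^sup>2) * tail (e x - \<mu>) \<partial>lborel) = (\<integral>x. p ((x - \<mu>)\<^sup>2) * tail (e' x - \<mu>) \<partial>lborel)"
    by (intro integral_cong_AE) measurable
  then show ?thesis by (simp add: L1_risk_plug_in(1))
qed

end

theorem corollary5p3:
  fixes q p :: "real \<Rightarrow> real" and a b :: real and S :: "real set"
  assumes "symmetric_density q" and "unimodal_symmetric q"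
    and "symmetric_density p" and "logconcave (\<lambda>t. p (t\<^sup>2))"
    and "a < b" and "S = {a<..<b} \<or> S = {a<..}"
  shows "(\<exists>\<delta>. bayes_estimator q p S \<delta> \<and>
            dominates q p S (plug_in q \<delta>) (plug_in q (\<lambda>x. x))) \<and>
         (\<forall>\<delta>. essentially_unique_bayes_estimator q p S \<delta> \<longrightarrow>
            dominates q p S (plug_in q \<delta>) (plug_in q (\<lambda>x. x)))"
proof -
  interpret restricted_density_estimation q p a b S
    using assms by unfold_locales
  have "dominates q p S (plug_in q e) (plug_in q (\<lambda>x. x))"
    if "essentially_unique_bayes_estimator q p S e" for e
  proof -
    have e: "e \<in> borel_measurable borel" "AE x in lborel. 0 < marginal p S x \<longrightarrow> \<delta> x = e x"
      using that bayes_estimator_\<delta>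
      by (auto simp: essentially_unique_bayes_estimator_def bayes_estimator_def)
    have "L1_risk q p (plug_in q \<delta>) \<mu> = L1_risk q p (plug_in q e) \<mu>" if "\<mu> \<in> S" for \<mu>
      using L1_risk_cong_AE[OF \<delta>_meas e(1,2) that] .
    with dominates_\<delta> show ?thesis by (simp add: dominates_def)
  qed
  with bayes_estimator_\<delta> dominates_\<delta> show ?thesis by blast
qed

end
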